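(* The d-logic of all products of all $T_1$ spaces is $\langle\mathsf{K4},\mathsf{K4}\rangle$; that is, the set of all bimodal formulas $A$ such that $\mathfrak X_1\times\mathfrak X_2\models_d A$ for all $T_1$ topological spaces $\mathfrak X_1,\mathfrak X_2$ equals $\langle\mathsf{K4},\mathsf{K4}\rangle$.
   Context: A (normal modal) logic is a set of modal formulas (built from propositional letters, $\bot$, $\to$, $\Box_i$) containing all classical tautologies and $\Box_i(p\to q)\to(\Box_i p\to\Box_i q)$, closed under substitution, modus ponens and $A/\Box_i A$. $\mathsf{K}_n$ is the minimal one with $n$ modalities, $\mathsf K=\mathsf K_1$, and $\mathsf{L}+\Gamma$ is the minimal logic containing $\mathsf{L}\cup\Gamma$. $\mathsf{K4}=\mathsf K+\Box p\to\Box\Box p$. A formula is closed if it contains no propositional letters. Fusion: $\mathsf{L}_1*\mathsf{L}_2=\mathsf{K}_2+\mathsf{L}_1'+\mathsf{L}_2'$, where $\mathsf{L}_i'$ is $\mathsf{L}_i$ with every $\Box$ replaced by $\Box_i$. Let $\Delta=\{B\to\Box_2B : B \text{ closed and } \Box_2\text{-free}\}\cup\{B\to\Box_1B: B\text{ closed and }\Box_1\text{-free}\}$ and $\langle \mathsf{L}_1,\mathsf{L}_2\rangle=\mathsf{L}_1*\mathsf{L}_2+\Delta$. A neighborhood frame (n-frame) is $(X,\tau)$ with $X\neq\varnothing$ and each $\tau(x)$ a filter on $X$ (possibly containing $\varnothing$); an n-2-frame $(X,\tau_1,\tau_2)$ has two such functions. For a valuation, $x\models\Box_iA$ iff there is $U\in\tau_i(x)$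 with $y\models A$ for all $y\in U$; Boolean connectives as usual; validity means truth at all points under all valuations. Product of n-frames: $(X_1,\tau_1)\times(X_2,\tau_2)=(X_1\times X_2,\tau_1^h,\tau_2^v)$, where $\tau_1^h(x_1,x_2)=\{U: \exists V\in\tau_1(x_1)\ V\times\{x_2\}\subseteq U\}$ and $\tau_2^v(x_1,x_2)=\{U:\exists V\in\tau_2(x_2)\ \{x_1\}\times V\subseteq U\}$. Derivational semantics: for a topological space $\mathfrak X=(X,T)$ ($X\ne\varnothing$), let $\tau_d^{\mathfrak X}(x)=\{U\subseteq X: \exists U'\in T\ (x\in U',\ U'\setminus\{x\}\subseteq U)\}$ and $\mathcal N_d(\mathfrak X)=(X,\tau_d^{\mathfrak X})$. For the product of topological spaces (the bitopological product with horizontal and vertical topologies, not the Tychonoff product), $\mathfrak X_1\times\mathfrak X_2\models_dA$ means that the bimodal formula $A$ is valid in the n-2-frame $\mathcal N_d(\mathfrak X_1)\times\mathcal N_d(\mathfrak X_2)$. *)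

theory Defs
  imports "HOL-Analysis.T1_Spaces"
begin

section \<open>Modal formulas and normal modal logics\<close>

text \<open>
  The type parameter \<open>'i\<close> indexes the boxes, so that \<open>unit fm\<close> is the unimodal and
  \<open>modality fm\<close> the bimodal language; the propositional letters are \<open>Var 0, Var 1, \<dots>\<close>.
  The set function \<open>boxes\<close> collects the indices of the boxes occurring in a formula.
\<close>

datatype (boxes: 'i) fm =
    Var nat
  | Bot
  | Imp "'i fm" "'i fm"  (infixr "\<rightarrow>\<^sub>m" 60)
  | Box 'i "'i fm"

datatype modality = M1 | M2

primrec letters :: "'i fm \<Rightarrow> nat set" where
  "letters (Var p) = {p}"
| "letters Bot = {}"
| "letters (A \<rightarrow>\<^sub>m B) = letters A \<union> letters B"
| "letters (Box i A) = letters A"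

definition closed_fm :: "'i fm \<Rightarrow> bool" where
  "closed_fm A \<longleftrightarrow> letters A = {}"

primrec subst :: "(nat \<Rightarrow> 'i fm) \<Rightarrow> 'i fm \<Rightarrow> 'i fm" where
  "subst s (Var p) = s p"
| "subst s Bot = Bot"
| "subst s (A \<rightarrow>\<^sub>m B) = subst s A \<rightarrow>\<^sub>m subst s B"
| "subst s (Box i A) = Box i (subst s A)"

text \<open>
  Classical truth-table evaluation; a boxed formula is treated as an atom, so the tautologies
  include the modal substitution instances of the propositional ones.
\<close>

primrec peval :: "('i fm \<Rightarrow> bool) \<Rightarrow> 'i fm \<Rightarrow> bool" where
  "peval v (Var p) \<longleftrightarrow> v (Var p)"
| "peval v Bot \<longleftrightarrow> False"
| "peval v (A \<rightarrow>\<^sub>m B) \<longleftrightarrow> (peval v A \<longrightarrow> peval v B)"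
| "peval v (Box i A) \<longleftrightarrow> v (Box i A)"

definition tautology :: "'i fm \<Rightarrow> bool" where
  "tautology A \<longleftrightarrow> (\<forall>v. peval v A)"

definition normal_logic :: "'i fm set \<Rightarrow> bool" where
  "normal_logic L \<longleftrightarrow>
     (\<forall>A. tautology A \<longrightarrow> A \<in> L) \<and>
     (\<forall>i. Box i (Var 0 \<rightarrow>\<^sub>m Var 1) \<rightarrow>\<^sub>m Box i (Var 0) \<rightarrow>\<^sub>m Box i (Var 1) \<in> L) \<and>
     (\<forall>A s. A \<in> L \<longrightarrow> subst s A \<in> L) \<and>
     (\<forall>A B. A \<in> L \<and> A \<rightarrow>\<^sub>m B \<in> L \<longrightarrow> B \<in> L) \<and>
     (\<forall>A i. A \<in> L \<longrightarrow> Box i A \<in> L)"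

definition logic_plus :: "'i fm set \<Rightarrow> 'i fm set \<Rightarrow> 'i fm set"  (infixl "\<oplus>\<^sub>m" 65) where
  "L \<oplus>\<^sub>m \<Gamma> = \<Inter> {L'. normal_logic L' \<and> L \<union> \<Gamma> \<subseteq> L'}"

definition logic_K :: "'i fm set" where
  "logic_K = \<Inter> {L. normal_logic L}"

definition logic_K4 :: "unit fm set" where
  "logic_K4 = logic_K \<oplus>\<^sub>m {Box () (Var 0) \<rightarrow>\<^sub>m Box () (Box () (Var 0))}"

definition fusion :: "unit fm set \<Rightarrow> unit fm set \<Rightarrow> modality fm set" where
  "fusion L1 L2 = logic_K \<oplus>\<^sub>m map_fm (\<lambda>_. M1) ` L1 \<oplus>\<^sub>m map_fm (\<lambda>_. M2) ` L2"

definition Delta :: "modality fm set" where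
  "Delta = {B \<rightarrow>\<^sub>m Box M2 B | B. closed_fm B \<and> M2 \<notin> boxes B} \<union>
           {B \<rightarrow>\<^sub>m Box M1 B | B. closed_fm B \<and> M1 \<notin> boxes B}"

definition fusion_Delta :: "unit fm set \<Rightarrow> unit fm set \<Rightarrow> modality fm set"
  ("\<langle>_,/ _\<rangle>\<^sub>m") where
  "\<langle>L1, L2\<rangle>\<^sub>m = fusion L1 L2 \<oplus>\<^sub>m Delta"

lemma normal_logic_logic_plus: "normal_logic (L \<oplus>\<^sub>m \<Gamma>)"
  unfolding logic_plus_def normal_logic_def by blast


section \<open>Neighborhood frames and their products\<close>

type_synonym 'a nframe = "'a set \<times> ('a \<Rightarrow> 'a set set)"
type_synonym 'a nframe2 = "'a set \<times> ('a \<Rightarrow> 'a set set) \<times> ('a \<Rightarrow> 'a set set)"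

definition filter_on :: "'a set \<Rightarrow> 'a set set \<Rightarrow> bool" where
  "filter_on X F \<longleftrightarrow> F \<subseteq> Pow X \<and> X \<in> F \<and>
     (\<forall>U V. U \<in> F \<and> U \<subseteq> V \<and> V \<subseteq> X \<longrightarrow> V \<in> F) \<and>
     (\<forall>U V. U \<in> F \<and> V \<in> F \<longrightarrow> U \<inter> V \<in> F)"

fun is_nframe :: "'a nframe \<Rightarrow> bool" where
  "is_nframe (X, \<tau>) \<longleftrightarrow> X \<noteq> {} \<and> (\<forall>x\<in>X. filter_on X (\<tau> x))"

fun is_nframe2 :: "'a nframe2 \<Rightarrow> bool" where
  "is_nframe2 (X, \<tau>\<^sub>1, \<tau>\<^sub>2) \<longleftrightarrow>
     X \<noteq> {} \<and> (\<forall>x\<in>X. filter_on X (\<tau>\<^sub>1 x) \<and> filter_on X (\<tau>\<^sub>2 x))"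

fun points :: "'a nframe2 \<Rightarrow> 'a set" where
  "points (X, \<tau>\<^sub>1, \<tau>\<^sub>2) = X"

fun nbhds :: "'a nframe2 \<Rightarrow> modality \<Rightarrow> 'a \<Rightarrow> 'a set set" where
  "nbhds (X, \<tau>\<^sub>1, \<tau>\<^sub>2) M1 = \<tau>\<^sub>1"
| "nbhds (X, \<tau>\<^sub>1, \<tau>\<^sub>2) M2 = \<tau>\<^sub>2"

primrec sat :: "'a nframe2 \<Rightarrow> (nat \<Rightarrow> 'a set) \<Rightarrow> 'a \<Rightarrow> modality fm \<Rightarrow> bool" where
  "sat F V x (Var p) \<longleftrightarrow> x \<in> V p"
| "sat F V x Bot \<longleftrightarrow> False"
| "sat F V x (A \<rightarrow>\<^sub>m B) \<longleftrightarrow> (sat F V x A \<longrightarrow> sat F V x B)"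
| "sat F V x (Box i A) \<longleftrightarrow> (\<exists>U\<in>nbhds F i x. \<forall>y\<in>U. sat F V y A)"

definition valid :: "'a nframe2 \<Rightarrow> modality fm \<Rightarrow> bool" where
  "valid F A \<longleftrightarrow> (\<forall>V. (\<forall>p. V p \<subseteq> points F) \<longrightarrow> (\<forall>x\<in>points F. sat F V x A))"

fun nprod :: "'a nframe \<Rightarrow> 'b nframe \<Rightarrow> ('a \<times> 'b) nframe2"  (infixr "\<times>\<^sub>n" 80) where
  "(X\<^sub>1, \<tau>\<^sub>1) \<times>\<^sub>n (X\<^sub>2, \<tau>\<^sub>2) =
     (X\<^sub>1 \<times> X\<^sub>2,
      (\<lambda>(x\<^sub>1, x\<^sub>2). {U. U \<subseteq> X\<^sub>1 \<times> X\<^sub>2 \<and> (\<exists>V\<in>\<tau>\<^sub>1 x\<^sub>1. V \<times> {x\<^sub>2} \<subseteq> U)}),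
      (\<lambda>(x\<^sub>1, x\<^sub>2). {U. U \<subseteq> X\<^sub>1 \<times> X\<^sub>2 \<and> (\<exists>V\<in>\<tau>\<^sub>2 x\<^sub>2. {x\<^sub>1} \<times> V \<subseteq> U)}))"

lemma is_nframe2_nprod:
  assumes "is_nframe F" "is_nframe G"
  shows "is_nframe2 (F \<times>\<^sub>n G)"
proof -
  obtain X \<sigma> Y \<tau> where F: "F = (X, \<sigma>)" and G: "G = (Y, \<tau>)"
    by (metis surj_pair)
  have filter: "filter_on Z {U. U \<subseteq> Z \<and> (\<exists>V\<in>S. f V \<subseteq> U)}"
    if "filter_on W S" "f W \<subseteq> Z" "\<And>U V. f (U \<inter> V) \<subseteq> f U \<inter> f V"
    for W :: "'c set" and S and Z :: "('a \<times> 'b) set" and f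
    unfolding filter_on_def
  proof (intro conjI allI impI)
    show "Z \<in> {U. U \<subseteq> Z \<and> (\<exists>V\<in>S. f V \<subseteq> U)}"
      using that by (auto simp: filter_on_def)
  next
    fix U V
    assume "U \<in> {U. U \<subseteq> Z \<and> (\<exists>V\<in>S. f V \<subseteq> U)} \<and> V \<in> {U. U \<subseteq> Z \<and> (\<exists>V\<in>S. f V \<subseteq> U)}"
    then obtain P Q where "U \<subseteq> Z" "V \<subseteq> Z" "P \<in> S" "f P \<subseteq> U" "Q \<in> S" "f Q \<subseteq> V" by blast
    moreover from this have "P \<inter> Q \<in> S" "f (P \<inter> Q) \<subseteq> U \<inter> V"
      using that(1) that(3)[of P Q] by (auto simp: filter_on_def)
    ultimately show "U \<inter> V \<in> {U. U \<subseteq> Z \<and> (\<exists>V\<in>S. f V \<subseteq> U)}" by blast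
  qed blast+
  have "filter_on (X \<times> Y) {U. U \<subseteq> X \<times> Y \<and> (\<exists>V\<in>\<sigma> x. V \<times> {y} \<subseteq> U)}"
    and "filter_on (X \<times> Y) {U. U \<subseteq> X \<times> Y \<and> (\<exists>V\<in>\<tau> y. {x} \<times> V \<subseteq> U)}"
    if "x \<in> X" "y \<in> Y" for x y
    using assms that
    by (auto simp: F G intro!: filter[of X _ "\<lambda>V. V \<times> {y}"] filter[of Y _ "\<lambda>V. {x} \<times> V"])
  then show ?thesis
    using assms by (auto simp: F G)
qed


section \<open>Derivational semantics\<close>

definition derivational_nframe :: "'a topology \<Rightarrow> 'a nframe"  ("\<N>\<^sub>d") where
  "\<N>\<^sub>d X = (topspace X,
     \<lambda>x. {U. U \<subseteq> topspace X \<and> (\<exists>U'. openin X U' \<and> x \<in> U' \<and> U' - {x} \<subseteq> U)})"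

lemma is_nframe_derivational_nframe:
  assumes "topspace X \<noteq> {}"
  shows "is_nframe (\<N>\<^sub>d X)"
proof -
  let ?\<tau> = "\<lambda>x. {U. U \<subseteq> topspace X \<and> (\<exists>U'. openin X U' \<and> x \<in> U' \<and> U' - {x} \<subseteq> U)}"
  have "filter_on (topspace X) (?\<tau> x)" if "x \<in> topspace X" for x
    unfolding filter_on_def
  proof (intro conjI allI impI)
    show "topspace X \<in> ?\<tau> x"
      using that by blast
  next
    fix U V
    assume "U \<in> ?\<tau> x \<and> V \<in> ?\<tau> x"
    then obtain P Q where "U \<subseteq> topspace X" "openin X P" "x \<in> P" "P - {x} \<subseteq> U"
      "openin X Q" "x \<in> Q" "Q - {x} \<subseteq> V" by blast
    moreover from this have "openin X (P \<inter> Q)" "P \<inter> Q - {x} \<subseteq> U \<inter> V" by auto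
    ultimately show "U \<inter> V \<in> ?\<tau> x" by blast
  qed blast+
  then show ?thesis
    using assms by (simp add: derivational_nframe_def)
qed

definition d_valid :: "'a topology \<Rightarrow> 'b topology \<Rightarrow> modality fm \<Rightarrow> bool" where
  "d_valid X\<^sub>1 X\<^sub>2 A \<longleftrightarrow> valid (\<N>\<^sub>d X\<^sub>1 \<times>\<^sub>n \<N>\<^sub>d X\<^sub>2) A"

end

theory Submission
  imports Defs
begin

text \<open>
  Completeness rests on the canonical model. The set of closed \<open>\<box>\<^sub>i\<close>-formulas true at a point
  is its \<open>i\<close>-type; \<open>Delta\<close> says that moving along \<open>R\<^sub>j\<close> with \<open>j \<noteq> i\<close> preserves \<open>i\<close>-types, and the
  map to \<open>i\<close>-types is a bounded morphism for \<open>R\<^sub>i\<close>. A Skolem hull makes the model countable.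

  The two spaces consist of finite sequences of moves, each with a time stamp; a move names a target
  point, and whether it may be made depends on the \<open>i\<close>-type alone. A move is therefore executable
  whatever the other coordinate is, possibly by going to another point with the same \<open>i\<close>-type as
  its target. A pair of sequences is sent to the point reached by executing all moves in the order
  of their stamps. The basic punctured neighborhoods of a sequence consist of its extensions by
  moves with large stamps: when the stamps exceed those of the other coordinate, the new
  moves are executed last, so by transitivity they lead exactly to the \<open>R\<^sub>i\<close>-successors.
\<close>

section \<open>Normal logics\<close>

locale normal =
  fixes L :: "'i fm set"
  assumes normal: "normal_logic L"
begin

lemma taut: "tautology A \<Longrightarrow> A \<in> L"
  using normal unfolding normal_logic_def by blast

lemma mp: "A \<in> L \<Longrightarrow> A \<rightarrow>\<^sub>m B \<in> L \<Longrightarrow> B \<in> L"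
  using normal unfolding normal_logic_def by blast

lemma nec: "A \<in> L \<Longrightarrow> Box i A \<in> L"
  using normal unfolding normal_logic_def by blast

lemma substitution: "A \<in> L \<Longrightarrow> subst s A \<in> L"
  using normal unfolding normal_logic_def by blast

lemma distribution: "Box i (Var 0 \<rightarrow>\<^sub>m Var 1) \<rightarrow>\<^sub>m Box i (Var 0) \<rightarrow>\<^sub>m Box i (Var 1) \<in> L"
  using normal unfolding normal_logic_def by blast

end

lemma logic_plus_upper:
  shows logic_plus_upper1: "L \<subseteq> L \<oplus>\<^sub>m \<Gamma>" and logic_plus_upper2: "\<Gamma> \<subseteq> L \<oplus>\<^sub>m \<Gamma>"
  unfolding logic_plus_def by blast+

lemma logic_plus_least:
  "normal_logic L' \<Longrightarrow> L \<subseteq> L' \<Longrightarrow> \<Gamma> \<subseteq> L' \<Longrightarrow> L \<oplus>\<^sub>m \<Gamma> \<subseteq> L'"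
  unfolding logic_plus_def by blast

lemma logic_K_least: "normal_logic L \<Longrightarrow> logic_K \<subseteq> L"
  unfolding logic_K_def by blast

section \<open>Soundness\<close>

lemma peval_sat: "peval (sat F V x) A \<longleftrightarrow> sat F V x A"
  by (induction A) auto

lemma nbhds_filter_on:
  assumes "is_nframe2 F" "x \<in> points F"
  shows "filter_on (points F) (nbhds F i x)"
  using assms by (cases F; cases i) auto

lemma nbhds_subset_points:
  assumes "is_nframe2 F" "x \<in> points F" "U \<in> nbhds F i x"
  shows "U \<subseteq> points F"
  using nbhds_filter_on[OF assms(1,2), of i] assms(3) by (auto simp: filter_on_def)

lemma sat_subst:
  assumes "is_nframe2 F" "x \<in> points F"
  shows "sat F V x (subst s A) \<longleftrightarrow> sat F (\<lambda>p. {y \<in> points F. sat F V y (s p)}) x A"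
    (is "_ \<longleftrightarrow> sat F ?W x A")
  using assms(2)
proof (induction A arbitrary: x)
  case (Box i A)
  have "(\<forall>y\<in>U. sat F V y (subst s A)) \<longleftrightarrow> (\<forall>y\<in>U. sat F ?W y A)" if "U \<in> nbhds F i x" for U
    using nbhds_subset_points[OF assms(1) Box.prems that] Box.IH by blast
  then show ?case
    by simp
qed auto

text \<open>Closure of filters under intersection yields the distribution axiom; membership of the
  whole carrier yields necessitation.\<close>

lemma normal_logic_valid:
  assumes F: "is_nframe2 F"
  shows "normal_logic {A. valid F A}"
proof -
  have taut: "valid F A" if "tautology A" for A
    using that by (metis peval_sat tautology_def valid_def)
  have K: "valid F (Box i (Var 0 \<rightarrow>\<^sub>m Var 1) \<rightarrow>\<^sub>m Box i (Var 0) \<rightarrow>\<^sub>m Box i (Var 1))" for i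
    unfolding valid_def
  proof (intro allI impI ballI)
    fix V :: "nat \<Rightarrow> 'a set" and x
    assume x: "x \<in> points F"
    have "sat F V x (Box i (Var 1))"
      if PQ: "P \<in> nbhds F i x" "\<forall>y\<in>P. y \<in> V 0 \<longrightarrow> y \<in> V 1" "Q \<in> nbhds F i x" "\<forall>y\<in>Q. y \<in> V 0"
      for P Q
    proof -
      have "P \<inter> Q \<in> nbhds F i x"
        using nbhds_filter_on[OF F x, of i] PQ(1,3) by (simp add: filter_on_def)
      moreover have "\<forall>y\<in>P \<inter> Q. y \<in> V 1"
        using PQ(2,4) by blast
      ultimately show ?thesis
        by (simp only: sat.simps) blast
    qed
    then show "sat F V x (Box i (Var 0 \<rightarrow>\<^sub>m Var 1) \<rightarrow>\<^sub>m Box i (Var 0) \<rightarrow>\<^sub>m Box i (Var 1))"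
      by auto
  qed
  have subst: "valid F (subst s A)" if "valid F A" for A s
    using that by (auto simp: valid_def sat_subst[OF F])
  have mp: "valid F B" if "valid F A" "valid F (A \<rightarrow>\<^sub>m B)" for A B
    using that by (auto simp: valid_def)
  have nec: "valid F (Box i A)" if "valid F A" for A i
    unfolding valid_def
  proof (intro allI impI ballI)
    fix V :: "nat \<Rightarrow> 'a set" and x
    assume "\<forall>p. V p \<subseteq> points F" and x: "x \<in> points F"
    moreover have "points F \<in> nbhds F i x"
      using nbhds_filter_on[OF F x, of i] by (simp add: filter_on_def)
    ultimately show "sat F V x (Box i A)"
      using that unfolding valid_def sat.simps by blast
  qed
  show ?thesis
    unfolding normal_logic_def mem_Collect_eq
  proof (intro conjI allI impI)
    fix A B
    assume "valid F A \<and> valid F (A \<rightarrow>\<^sub>m B)"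
    then show "valid F B"
      using mp by blast
  qed (fact taut K subst nec)+
qed

section \<open>Box clauses and axioms in products of derivational frames\<close>

lemma sat_derivational_M1:
  assumes "x\<^sub>2 \<in> topspace X\<^sub>2"
  shows "sat (\<N>\<^sub>d X\<^sub>1 \<times>\<^sub>n \<N>\<^sub>d X\<^sub>2) V (x\<^sub>1, x\<^sub>2) (Box M1 A) \<longleftrightarrow>
    (\<exists>U. openin X\<^sub>1 U \<and> x\<^sub>1 \<in> U \<and> (\<forall>y\<in>U - {x\<^sub>1}. sat (\<N>\<^sub>d X\<^sub>1 \<times>\<^sub>n \<N>\<^sub>d X\<^sub>2) V (y, x\<^sub>2) A))"
    (is "?L \<longleftrightarrow> ?R")
proof
  assume ?L
  then obtain W where W: "W \<in> nbhds (\<N>\<^sub>d X\<^sub>1 \<times>\<^sub>n \<N>\<^sub>d X\<^sub>2) M1 (x\<^sub>1, x\<^sub>2)"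
    "\<forall>z\<in>W. sat (\<N>\<^sub>d X\<^sub>1 \<times>\<^sub>n \<N>\<^sub>d X\<^sub>2) V z A"
    unfolding sat.simps by blast
  from W(1) obtain P U where P: "P \<times> {x\<^sub>2} \<subseteq> W" and U: "openin X\<^sub>1 U" "x\<^sub>1 \<in> U" "U - {x\<^sub>1} \<subseteq> P"
    by (auto simp: derivational_nframe_def)
  have "(y, x\<^sub>2) \<in> W" if "y \<in> U - {x\<^sub>1}" for y
    using P U(3) that by blast
  with U W(2) show ?R
    by blast
next
  assume ?R
  then obtain U where U: "openin X\<^sub>1 U" "x\<^sub>1 \<in> U"
    "\<forall>y\<in>U - {x\<^sub>1}. sat (\<N>\<^sub>d X\<^sub>1 \<times>\<^sub>n \<N>\<^sub>d X\<^sub>2) V (y, x\<^sub>2) A" by blast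
  \<comment> \<open>The punctured slice is the least neighborhood that \<open>U\<close> gives rise
    to; the assumption on \<open>x\<^sub>2\<close> places it inside the carrier.\<close>
  have "(U - {x\<^sub>1}) \<times> {x\<^sub>2} \<in> nbhds (\<N>\<^sub>d X\<^sub>1 \<times>\<^sub>n \<N>\<^sub>d X\<^sub>2) M1 (x\<^sub>1, x\<^sub>2)"
    using U(1,2) openin_subset[OF U(1)] assms by (auto simp: derivational_nframe_def)
  moreover have "\<forall>z\<in>(U - {x\<^sub>1}) \<times> {x\<^sub>2}. sat (\<N>\<^sub>d X\<^sub>1 \<times>\<^sub>n \<N>\<^sub>d X\<^sub>2) V z A"
    using U(3) by blast
  ultimately show ?L
    unfolding sat.simps by blast
qed

lemma sat_derivational_M2:
  assumes "x\<^sub>1 \<in> topspace X\<^sub>1"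
  shows "sat (\<N>\<^sub>d X\<^sub>1 \<times>\<^sub>n \<N>\<^sub>d X\<^sub>2) V (x\<^sub>1, x\<^sub>2) (Box M2 A) \<longleftrightarrow>
    (\<exists>U. openin X\<^sub>2 U \<and> x\<^sub>2 \<in> U \<and> (\<forall>y\<in>U - {x\<^sub>2}. sat (\<N>\<^sub>d X\<^sub>1 \<times>\<^sub>n \<N>\<^sub>d X\<^sub>2) V (x\<^sub>1, y) A))"
    (is "?L \<longleftrightarrow> ?R")
proof
  assume ?L
  then obtain W where W: "W \<in> nbhds (\<N>\<^sub>d X\<^sub>1 \<times>\<^sub>n \<N>\<^sub>d X\<^sub>2) M2 (x\<^sub>1, x\<^sub>2)"
    "\<forall>z\<in>W. sat (\<N>\<^sub>d X\<^sub>1 \<times>\<^sub>n \<N>\<^sub>d X\<^sub>2) V z A"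
    unfolding sat.simps by blast
  from W(1) obtain P U where P: "{x\<^sub>1} \<times> P \<subseteq> W" and U: "openin X\<^sub>2 U" "x\<^sub>2 \<in> U" "U - {x\<^sub>2} \<subseteq> P"
    by (auto simp: derivational_nframe_def)
  have "(x\<^sub>1, y) \<in> W" if "y \<in> U - {x\<^sub>2}" for y
    using P U(3) that by blast
  with U W(2) show ?R
    by blast
next
  assume ?R
  then obtain U where U: "openin X\<^sub>2 U" "x\<^sub>2 \<in> U"
    "\<forall>y\<in>U - {x\<^sub>2}. sat (\<N>\<^sub>d X\<^sub>1 \<times>\<^sub>n \<N>\<^sub>d X\<^sub>2) V (x\<^sub>1, y) A" by blast
  have "{x\<^sub>1} \<times> (U - {x\<^sub>2}) \<in> nbhds (\<N>\<^sub>d X\<^sub>1 \<times>\<^sub>n \<N>\<^sub>d X\<^sub>2) M2 (x\<^sub>1, x\<^sub>2)"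
    using U(1,2) openin_subset[OF U(1)] assms by (auto simp: derivational_nframe_def)
  moreover have "\<forall>z\<in>{x\<^sub>1} \<times> (U - {x\<^sub>2}). sat (\<N>\<^sub>d X\<^sub>1 \<times>\<^sub>n \<N>\<^sub>d X\<^sub>2) V z A"
    using U(3) by blast
  ultimately show ?L
    unfolding sat.simps by blast
qed

lemma points_derivational_product: "points (\<N>\<^sub>d X\<^sub>1 \<times>\<^sub>n \<N>\<^sub>d X\<^sub>2) = topspace X\<^sub>1 \<times> topspace X\<^sub>2"
  by (simp add: derivational_nframe_def)

text \<open>In a T1 space the punctured set \<open>U - {x}\<close> is open, so it witnesses the
  inner box at each of its points, while \<open>U\<close> witnesses the outer one.\<close>

lemma d_valid_transitivity:
  assumes "t1_space X\<^sub>1" "t1_space X\<^sub>2"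
  shows "d_valid X\<^sub>1 X\<^sub>2 (Box i (Var 0) \<rightarrow>\<^sub>m Box i (Box i (Var 0)))"
proof (cases i)
  case M1
  have "sat (\<N>\<^sub>d X\<^sub>1 \<times>\<^sub>n \<N>\<^sub>d X\<^sub>2) V (x, y) (Box M1 (Box M1 (Var 0)))"
    if y: "y \<in> topspace X\<^sub>2" and sat: "sat (\<N>\<^sub>d X\<^sub>1 \<times>\<^sub>n \<N>\<^sub>d X\<^sub>2) V (x, y) (Box M1 (Var 0))" for V x y
  proof -
    obtain U where U: "openin X\<^sub>1 U" "x \<in> U" "\<forall>z\<in>U - {x}. (z, y) \<in> V 0"
      using sat unfolding sat_derivational_M1[OF y] by auto
    have "openin X\<^sub>1 (U - {x})"
      using U(1,2) assms(1) openin_subset[OF U(1)] by (auto intro!: openin_diff simp: closedin_t1_singleton)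
    then show ?thesis
      unfolding sat_derivational_M1[OF y] using U by (metis DiffD1 sat.simps(1))
  qed
  then show ?thesis
    unfolding M1 d_valid_def valid_def points_derivational_product by auto
next
  case M2
  have "sat (\<N>\<^sub>d X\<^sub>1 \<times>\<^sub>n \<N>\<^sub>d X\<^sub>2) V (y, x) (Box M2 (Box M2 (Var 0)))"
    if y: "y \<in> topspace X\<^sub>1" and sat: "sat (\<N>\<^sub>d X\<^sub>1 \<times>\<^sub>n \<N>\<^sub>d X\<^sub>2) V (y, x) (Box M2 (Var 0))" for V x y
  proof -
    obtain U where U: "openin X\<^sub>2 U" "x \<in> U" "\<forall>z\<in>U - {x}. (y, z) \<in> V 0"
      using sat unfolding sat_derivational_M2[OF y] by auto
    have "openin X\<^sub>2 (U - {x})"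
      using U(1,2) assms(2) openin_subset[OF U(1)] by (auto intro!: openin_diff simp: closedin_t1_singleton)
    then show ?thesis
      unfolding sat_derivational_M2[OF y] using U by (metis DiffD1 sat.simps(1))
  qed
  then show ?thesis
    unfolding M2 d_valid_def valid_def points_derivational_product by auto
qed

text \<open>A horizontal box moves only the first coordinate and no letter consults the valuation,
  so the second coordinate never enters the truth value.\<close>

lemma sat_closed_M2_free:
  assumes "closed_fm B" "M2 \<notin> boxes B" "y \<in> topspace X\<^sub>2" "y' \<in> topspace X\<^sub>2"
  shows "sat (\<N>\<^sub>d X\<^sub>1 \<times>\<^sub>n \<N>\<^sub>d X\<^sub>2) V (x, y) B \<longleftrightarrow> sat (\<N>\<^sub>d X\<^sub>1 \<times>\<^sub>n \<N>\<^sub>d X\<^sub>2) V (x, y') B"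
  using assms(1,2)
proof (induction B arbitrary: x)
  case (Box i B)
  then have i: "i = M1" by (cases i) auto
  show ?case
    unfolding i sat_derivational_M1[OF assms(3)] sat_derivational_M1[OF assms(4)]
    using Box by (simp add: closed_fm_def)
qed (auto simp: closed_fm_def)

lemma sat_closed_M1_free:
  assumes "closed_fm B" "M1 \<notin> boxes B" "x \<in> topspace X\<^sub>1" "x' \<in> topspace X\<^sub>1"
  shows "sat (\<N>\<^sub>d X\<^sub>1 \<times>\<^sub>n \<N>\<^sub>d X\<^sub>2) V (x, y) B \<longleftrightarrow> sat (\<N>\<^sub>d X\<^sub>1 \<times>\<^sub>n \<N>\<^sub>d X\<^sub>2) V (x', y) B"
  using assms(1,2)
proof (induction B arbitrary: y)
  case (Box i B)
  then have i: "i = M2" by (cases i) auto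
  show ?case
    unfolding i sat_derivational_M2[OF assms(3)] sat_derivational_M2[OF assms(4)]
    using Box by (simp add: closed_fm_def)
qed (auto simp: closed_fm_def)

lemma d_valid_Delta:
  assumes "A \<in> Delta"
  shows "d_valid X\<^sub>1 X\<^sub>2 A"
proof -
  consider B where "A = B \<rightarrow>\<^sub>m Box M2 B" "closed_fm B" "M2 \<notin> boxes B"
    | B where "A = B \<rightarrow>\<^sub>m Box M1 B" "closed_fm B" "M1 \<notin> boxes B"
    using assms by (auto simp: Delta_def)
  then show ?thesis
  proof cases
    case 1
    \<comment> \<open>Since the truth of \<open>B\<close> is constant along the vertical fibre, the
      whole space serves as the neighborhood.\<close>
    have "sat (\<N>\<^sub>d X\<^sub>1 \<times>\<^sub>n \<N>\<^sub>d X\<^sub>2) V (x, y) A"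
      if "x \<in> topspace X\<^sub>1" "y \<in> topspace X\<^sub>2" for V x y
      unfolding 1(1) sat.simps(3) sat_derivational_M2[OF that(1)]
      using that(2) sat_closed_M2_free[OF 1(2,3) that(2), THEN iffD1]
      by (intro impI exI[of _ "topspace X\<^sub>2"] conjI ballI) auto
    then show ?thesis
      unfolding d_valid_def valid_def points_derivational_product by auto
  next
    case 2
    have "sat (\<N>\<^sub>d X\<^sub>1 \<times>\<^sub>n \<N>\<^sub>d X\<^sub>2) V (x, y) A"
      if "x \<in> topspace X\<^sub>1" "y \<in> topspace X\<^sub>2" for V x y
      unfolding 2(1) sat.simps(3) sat_derivational_M1[OF that(2)]
      using that(1) sat_closed_M1_free[OF 2(2,3) that(1), THEN iffD1]
      by (intro impI exI[of _ "topspace X\<^sub>1"] conjI ballI) auto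
    then show ?thesis
      unfolding d_valid_def valid_def points_derivational_product by auto
  qed
qed

section \<open>Translation of unimodal into bimodal logics\<close>

lemma peval_map_fm: "peval v (map_fm g A) \<longleftrightarrow> peval (v \<circ> map_fm g) A"
  by (induction A) auto

lemma map_fm_subst: "map_fm g (subst s A) = subst (map_fm g \<circ> s) (map_fm g A)"
  by (induction A) auto

text \<open>\<open>logic_K4\<close> is minimal among unimodal logics only, so a bimodal logic is
  pulled back along the renaming of boxes before this minimality applies.\<close>

lemma normal_logic_vimage_map_fm:
  fixes g :: "'i \<Rightarrow> 'j"
  assumes "normal_logic L"
  shows "normal_logic (map_fm g -` L)"
proof -
  interpret normal L
    using assms by unfold_locales
  show ?thesis
    unfolding normal_logic_def vimage_eq
  proof (intro conjI allI impI)
    fix A :: "'i fm"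
    assume "tautology A"
    then show "map_fm g A \<in> L"
      by (intro taut) (simp add: tautology_def peval_map_fm)
  next
    fix A B
    assume "map_fm g A \<in> L \<and> map_fm g (A \<rightarrow>\<^sub>m B) \<in> L"
    then show "map_fm g B \<in> L"
      using mp by auto
  next
    fix i
    show "map_fm g (Box i (Var 0 \<rightarrow>\<^sub>m Var 1) \<rightarrow>\<^sub>m Box i (Var 0) \<rightarrow>\<^sub>m Box i (Var 1)) \<in> L"
      using distribution by simp
  next
    fix A s
    assume "map_fm g A \<in> L"
    then show "map_fm g (subst s A) \<in> L"
      unfolding map_fm_subst by (rule substitution)
  next
    fix A i
    assume "map_fm g A \<in> L"
    then show "map_fm g (Box i A) \<in> L"
      unfolding fm.map by (rule nec)
  qed
qed

lemma fusion_Delta_K4_least: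
  assumes L: "normal_logic L" and "Delta \<subseteq> L"
    and four: "\<And>i. Box i (Var 0) \<rightarrow>\<^sub>m Box i (Box i (Var 0)) \<in> L"
  shows "\<langle>logic_K4, logic_K4\<rangle>\<^sub>m \<subseteq> L"
proof -
  have K4: "map_fm (\<lambda>_. i) ` logic_K4 \<subseteq> L" for i
  proof -
    have "normal_logic (map_fm (\<lambda>_. i) -` L :: unit fm set)"
      using L by (rule normal_logic_vimage_map_fm)
    then have "logic_K4 \<subseteq> map_fm (\<lambda>_. i) -` L"
      unfolding logic_K4_def using four[of i] by (intro logic_plus_least logic_K_least) auto
    then show ?thesis by auto
  qed
  show ?thesis
    unfolding fusion_Delta_def fusion_def
    by (intro logic_plus_least logic_K_least L K4 \<open>Delta \<subseteq> L\<close>)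
qed

text \<open>Together with normality, these two facts are all that completeness uses about the
  logic.\<close>

lemma fusion_Delta_K4:
  shows Delta_subset_fusion_Delta: "Delta \<subseteq> \<langle>L\<^sub>1, L\<^sub>2\<rangle>\<^sub>m"
    and transitivity_in_fusion_Delta:
      "Box i (Var 0) \<rightarrow>\<^sub>m Box i (Box i (Var 0)) \<in> \<langle>logic_K4, logic_K4\<rangle>\<^sub>m"
proof -
  show "Delta \<subseteq> \<langle>L\<^sub>1, L\<^sub>2\<rangle>\<^sub>m"
    unfolding fusion_Delta_def by (rule logic_plus_upper2)
  have "Box () (Var 0) \<rightarrow>\<^sub>m Box () (Box () (Var 0)) \<in> logic_K4"
    unfolding logic_K4_def using logic_plus_upper2 by (rule subsetD) simp
  moreover have "map_fm (\<lambda>_. i) ` logic_K4 \<subseteq> \<langle>logic_K4, logic_K4\<rangle>\<^sub>m"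
  proof (cases i)
    case M1
    show ?thesis
      unfolding M1 fusion_Delta_def fusion_def
      by (intro order_trans[OF _ logic_plus_upper1] logic_plus_upper2)
  next
    case M2
    show ?thesis
      unfolding M2 fusion_Delta_def fusion_def
      by (rule order_trans[OF logic_plus_upper2 logic_plus_upper1])
  qed
  ultimately show "Box i (Var 0) \<rightarrow>\<^sub>m Box i (Box i (Var 0)) \<in> \<langle>logic_K4, logic_K4\<rangle>\<^sub>m"
    by force
qed

lemma d_valid_fusion_Delta_K4:
  assumes "A \<in> \<langle>logic_K4, logic_K4\<rangle>\<^sub>m"
    and "topspace X\<^sub>1 \<noteq> {}" "t1_space X\<^sub>1" "topspace X\<^sub>2 \<noteq> {}" "t1_space X\<^sub>2"
  shows "d_valid X\<^sub>1 X\<^sub>2 A"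
proof -
  have "normal_logic {A. d_valid X\<^sub>1 X\<^sub>2 A}"
    unfolding d_valid_def using assms(2,4)
    by (intro normal_logic_valid is_nframe2_nprod is_nframe_derivational_nframe)
  then have "\<langle>logic_K4, logic_K4\<rangle>\<^sub>m \<subseteq> {A. d_valid X\<^sub>1 X\<^sub>2 A}"
    using d_valid_Delta d_valid_transitivity[OF assms(3,5)]
    by (intro fusion_Delta_K4_least) auto
  then show ?thesis
    using assms(1) by blast
qed

section \<open>The canonical model\<close>

primrec imps :: "'i fm list \<Rightarrow> 'i fm \<Rightarrow> 'i fm" where
  "imps [] C = C"
| "imps (A # As) C = A \<rightarrow>\<^sub>m imps As C"

lemma peval_imps: "peval v (imps As C) \<longleftrightarrow> ((\<forall>A\<in>set As. peval v A) \<longrightarrow> peval v C)"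
  by (induction As) auto

text \<open>Local consequence: necessitation is available for theorems of \<open>L\<close>, never
  for premises in \<open>\<Gamma>\<close>, as the deduction theorem requires. Finite lists of
  premises make compactness immediate.\<close>

definition derives :: "'i fm set \<Rightarrow> 'i fm set \<Rightarrow> 'i fm \<Rightarrow> bool" where
  "derives L \<Gamma> C \<longleftrightarrow> (\<exists>As. set As \<subseteq> \<Gamma> \<and> imps As C \<in> L)"

definition mcs :: "'i fm set \<Rightarrow> 'i fm set \<Rightarrow> bool" where
  "mcs L w \<longleftrightarrow> \<not> derives L w Bot \<and> (\<forall>A. A \<in> w \<or> A \<rightarrow>\<^sub>m Bot \<in> w)"

definition canonical_rel :: "'i \<Rightarrow> 'i fm set \<Rightarrow> 'i fm set \<Rightarrow> bool" where
  "canonical_rel i w v \<longleftrightarrow> (\<forall>A. Box i A \<in> w \<longrightarrow> A \<in> v)"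

definition closed_type :: "'i \<Rightarrow> 'i fm set \<Rightarrow> 'i fm set" where
  "closed_type i w = {B \<in> w. closed_fm B \<and> boxes B \<subseteq> {i}}"

context normal
begin

lemma K_axiom: "Box i (A \<rightarrow>\<^sub>m B) \<rightarrow>\<^sub>m Box i A \<rightarrow>\<^sub>m Box i B \<in> L"
  using substitution[OF distribution, of "\<lambda>p. if p = 0 then A else B"] by simp

lemma imps_weaken:
  assumes "imps As C \<in> L" "\<And>v. peval v (imps As C) \<Longrightarrow> peval v (imps Bs D)"
  shows "imps Bs D \<in> L"
  using assms(2) by (intro mp[OF assms(1) taut]) (simp add: tautology_def)

lemma derives_mem: "A \<in> \<Gamma> \<Longrightarrow> derives L \<Gamma> A"
  unfolding derives_def by (rule exI[of _ "[A]"]) (auto simp: tautology_def intro!: taut)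

lemma derives_theorem: "A \<in> L \<Longrightarrow> derives L \<Gamma> A"
  unfolding derives_def by (rule exI[of _ "[]"]) simp

lemma derives_mp:
  assumes "derives L \<Gamma> A" "derives L \<Gamma> (A \<rightarrow>\<^sub>m B)"
  shows "derives L \<Gamma> B"
proof -
  obtain As Bs where "set As \<subseteq> \<Gamma>" "imps As A \<in> L" "set Bs \<subseteq> \<Gamma>" "imps Bs (A \<rightarrow>\<^sub>m B) \<in> L"
    using assms by (auto simp: derives_def)
  moreover have "imps As A \<rightarrow>\<^sub>m imps Bs (A \<rightarrow>\<^sub>m B) \<rightarrow>\<^sub>m imps (As @ Bs) B \<in> L"
    by (rule taut) (auto simp: tautology_def peval_imps)
  ultimately show ?thesis
    unfolding derives_def by (intro exI[of _ "As @ Bs"]) (auto dest: mp)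
qed

text \<open>Sorting the finite premise list by membership in \<open>\<Gamma>\<close> moves the
  remaining premises into the conclusion. Moving several at once serves
  \<open>closed_type_forward\<close>, where \<open>\<Delta>\<close> is a whole type.\<close>

lemma deduction:
  assumes "derives L (\<Gamma> \<union> \<Delta>) C"
  obtains Bs where "set Bs \<subseteq> \<Delta>" "derives L \<Gamma> (imps Bs C)"
proof -
  obtain As where As: "set As \<subseteq> \<Gamma> \<union> \<Delta>" "imps As C \<in> L"
    using assms by (auto simp: derives_def)
  let ?A = "filter (\<lambda>A. A \<in> \<Gamma>) As" and ?B = "filter (\<lambda>A. A \<notin> \<Gamma>) As"
  have "imps ?A (imps ?B C) \<in> L"
    by (rule imps_weaken[OF As(2)]) (auto simp: peval_imps)
  then show ?thesis
    using As(1) by (intro that[of ?B]) (auto simp: derives_def intro!: exI[of _ ?A])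
qed

text \<open>A derivation has finitely many premises, so an inconsistent union of a chain would make
  one of its members inconsistent; hence Zorn's lemma applies.\<close>

lemma lindenbaum:
  assumes "\<not> derives L \<Gamma> Bot"
  obtains w where "mcs L w" "\<Gamma> \<subseteq> w"
proof -
  let ?S = "{w. \<Gamma> \<subseteq> w \<and> \<not> derives L w Bot}"
  have "\<Union>C \<in> ?S" if C: "C \<noteq> {}" "subset.chain ?S C" for C
  proof -
    have "\<not> derives L (\<Union>C) Bot"
    proof
      assume "derives L (\<Union>C) Bot"
      then obtain As where As: "set As \<subseteq> \<Union>C" "imps As Bot \<in> L"
        by (auto simp: derives_def)
      obtain X where "X \<in> C" "set As \<subseteq> X"
        using finite_subset_Union_chain[OF finite_set As(1) C] by blast
      then show False
        using As(2) C(2) by (auto simp: derives_def subset.chain_def)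
    qed
    moreover have "\<Gamma> \<subseteq> \<Union>C"
      using C unfolding subset.chain_def by blast
    ultimately show ?thesis
      by blast
  qed
  moreover have "?S \<noteq> {}"
    using assms by blast
  ultimately obtain w where w: "w \<in> ?S" "\<And>X. X \<in> ?S \<Longrightarrow> w \<subseteq> X \<Longrightarrow> X = w"
    using subset_Zorn_nonempty[of ?S] by (metis (no_types, lifting))
  have neg: "derives L w (A \<rightarrow>\<^sub>m Bot)" if "A \<notin> w" for A
  proof -
    have "insert A w \<notin> ?S"
      using w(2)[of "insert A w"] that by blast
    then have "derives L (w \<union> {A}) Bot"
      using w(1) by auto
    then obtain Bs where Bs: "set Bs \<subseteq> {A}" "derives L w (imps Bs Bot)"
      using deduction by blast
    \<comment> \<open>\<open>Bs\<close> lists copies of \<open>A\<close>, possibly none; with none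
      the premise is \<open>Bot\<close>, and the implication is still a tautology.\<close>
    have "imps Bs Bot \<rightarrow>\<^sub>m A \<rightarrow>\<^sub>m Bot \<in> L"
      using Bs(1) by (intro taut) (auto simp: tautology_def peval_imps)
    then show ?thesis
      using Bs(2) derives_mp derives_theorem by blast
  qed
  have "A \<rightarrow>\<^sub>m Bot \<in> w" if "A \<notin> w" for A
  proof (rule ccontr)
    assume "A \<rightarrow>\<^sub>m Bot \<notin> w"
    \<comment> \<open>Applied to \<open>A\<close> and to its negation, \<open>neg\<close> derives
      \<open>A \<rightarrow>\<^sub>m Bot\<close> as well as the negation of that.\<close>
    then have "derives L w Bot"
      using neg that derives_mp by blast
    then show False
      using w(1) by simp
  qed
  then show ?thesis
    using w(1) by (intro that[of w]) (auto simp: mcs_def)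
qed

lemma mcs_closed:
  assumes "mcs L w" "derives L w A"
  shows "A \<in> w"
  using assms derives_mp derives_mem unfolding mcs_def by blast

lemma mcs_theorem: "mcs L w \<Longrightarrow> A \<in> L \<Longrightarrow> A \<in> w"
  by (simp add: derives_theorem mcs_closed)

lemma mcs_Bot: "mcs L w \<Longrightarrow> Bot \<notin> w"
  by (auto simp: mcs_def derives_mem)

lemma mcs_mp: "mcs L w \<Longrightarrow> A \<in> w \<Longrightarrow> A \<rightarrow>\<^sub>m B \<in> w \<Longrightarrow> B \<in> w"
  by (meson derives_mem derives_mp mcs_closed)

lemma mcs_Imp:
  assumes "mcs L w"
  shows "A \<rightarrow>\<^sub>m B \<in> w \<longleftrightarrow> (A \<in> w \<longrightarrow> B \<in> w)"
proof
  assume *: "A \<in> w \<longrightarrow> B \<in> w"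
  have "B \<rightarrow>\<^sub>m A \<rightarrow>\<^sub>m B \<in> w" "(A \<rightarrow>\<^sub>m Bot) \<rightarrow>\<^sub>m A \<rightarrow>\<^sub>m B \<in> w"
    by (intro mcs_theorem[OF assms] taut; simp add: tautology_def)+
  then show "A \<rightarrow>\<^sub>m B \<in> w"
    using * mcs_mp[OF assms] assms unfolding mcs_def by blast
qed (use mcs_mp[OF assms] in blast)

lemma mcs_imps:
  "mcs L w \<Longrightarrow> imps As C \<in> w \<longleftrightarrow> (set As \<subseteq> w \<longrightarrow> C \<in> w)"
  by (induction As) (auto simp: mcs_Imp)

text \<open>Necessitate the theorem behind the derivation, then let the distribution axiom peel off
  its premises one by one: each premise is boxed in \<open>w\<close>.\<close>

lemma mcs_derives_Box:
  assumes w: "mcs L w" and "derives L {A. Box i A \<in> w} C"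
  shows "Box i C \<in> w"
proof -
  obtain As where As: "set As \<subseteq> {A. Box i A \<in> w}" "imps As C \<in> L"
    using assms by (auto simp: derives_def)
  have "Box i (imps As C) \<in> w"
    by (intro mcs_theorem[OF w] nec As)
  then show ?thesis
    using As(1)
  proof (induction As)
    case (Cons A As)
    then have "Box i (imps As C) \<in> w"
      using mcs_theorem[OF w K_axiom] by (auto simp: mcs_Imp[OF w])
    then show ?case
      using Cons by simp
  qed simp
qed

text \<open>Otherwise the formulas boxed in \<open>w\<close> would derive \<open>C\<close>, and
  \<open>mcs_derives_Box\<close> would put \<open>Box i C\<close> into \<open>w\<close>.\<close>

lemma canonical_witness:
  assumes "mcs L w" "Box i C \<notin> w"
  obtains v where "mcs L v" "canonical_rel i w v" "C \<notin> v"
proof -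
  have "\<not> derives L ({A. Box i A \<in> w} \<union> {C \<rightarrow>\<^sub>m Bot}) Bot"
  proof
    assume "derives L ({A. Box i A \<in> w} \<union> {C \<rightarrow>\<^sub>m Bot}) Bot"
    then obtain Bs where "set Bs \<subseteq> {C \<rightarrow>\<^sub>m Bot}" "derives L {A. Box i A \<in> w} (imps Bs Bot)"
      using deduction by blast
    moreover from this have "imps Bs Bot \<rightarrow>\<^sub>m C \<in> L"
      by (intro taut) (auto simp: tautology_def peval_imps)
    ultimately have "derives L {A. Box i A \<in> w} C"
      using derives_mp derives_theorem by blast
    then show False
      using assms mcs_derives_Box by blast
  qed
  then obtain v where v: "mcs L v" "{A. Box i A \<in> w} \<union> {C \<rightarrow>\<^sub>m Bot} \<subseteq> v"
    using lindenbaum by metis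
  then show ?thesis
    using mcs_Imp mcs_Bot by (intro that[of v]) (auto simp: canonical_rel_def)
qed

section \<open>Types of points in the canonical model\<close>

lemma closed_type_eq:
  assumes "mcs L v" "mcs L u" "closed_type i u \<subseteq> v"
  shows "closed_type i v = closed_type i u"
proof -
  have "B \<in> u" if "B \<in> closed_type i v" for B
  proof (rule ccontr)
    assume "B \<notin> u"
    \<comment> \<open>The formulas eligible for a type are closed under negation, so an inclusion of
      types cannot be proper.\<close>
    then have "B \<rightarrow>\<^sub>m Bot \<in> closed_type i u"
      using that assms(2) by (auto simp: mcs_def closed_type_def closed_fm_def)
    then show False
      using assms that mcs_mp mcs_Bot unfolding closed_type_def by blast
  qed
  then show ?thesis
    using assms(3) by (auto simp: closed_type_def)
qed

text \<open>Without such a \<open>v\<close>, some \<open>Box i D\<close> would lie in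
  \<open>w\<close>, where \<open>D\<close> refutes finitely many formulas of the type of
  \<open>u'\<close>. This boxed formula is itself closed and uses no box but \<open>i\<close>, so it
  passes to \<open>u\<close> by equality of types. Then \<open>D\<close> lies in \<open>u'\<close>,
  next to the formulas that it refutes.\<close>

lemma closed_type_forward:
  assumes "mcs L w" "mcs L u" "mcs L u'"
    and "closed_type i w = closed_type i u" "canonical_rel i u u'"
  obtains v where "mcs L v" "canonical_rel i w v" "closed_type i v = closed_type i u'"
proof -
  have "\<not> derives L ({A. Box i A \<in> w} \<union> closed_type i u') Bot"
  proof
    assume "derives L ({A. Box i A \<in> w} \<union> closed_type i u') Bot"
    then obtain Bs where Bs: "set Bs \<subseteq> closed_type i u'" "derives L {A. Box i A \<in> w} (imps Bs Bot)"
      using deduction by blast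
    then have "Box i (imps Bs Bot) \<in> w"
      using assms mcs_derives_Box by blast
    moreover have "closed_fm (imps Bs Bot) \<and> boxes (imps Bs Bot) \<subseteq> {i}"
      using Bs(1) by (induction Bs) (auto simp: closed_type_def closed_fm_def)
    ultimately have "Box i (imps Bs Bot) \<in> closed_type i u"
      unfolding assms(4)[symmetric] by (auto simp: closed_type_def closed_fm_def)
    then have "imps Bs Bot \<in> u'"
      using assms(5) by (auto simp: closed_type_def canonical_rel_def)
    then show False
      using Bs(1) assms(3) mcs_Bot by (auto simp: mcs_imps closed_type_def)
  qed
  then obtain v where v: "mcs L v" "{A. Box i A \<in> w} \<union> closed_type i u' \<subseteq> v"
    using lindenbaum by metis
  show ?thesis
  proof (rule that)
    show "closed_type i v = closed_type i u'"
      using closed_type_eq[OF v(1) assms(3)] v(2) by blast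
    show "canonical_rel i w v"
      using v(2) unfolding canonical_rel_def by blast
  qed (fact v(1))
qed

lemma canonical_rel_trans:
  assumes "\<And>i. Box i (Var 0) \<rightarrow>\<^sub>m Box i (Box i (Var 0)) \<in> L"
    and "mcs L u" "canonical_rel i u v" "canonical_rel i v w"
  shows "canonical_rel i u w"
proof -
  have "Box i A \<rightarrow>\<^sub>m Box i (Box i A) \<in> L" for A
    using substitution[OF assms(1), of "\<lambda>_. A"] by simp
  then have "Box i (Box i A) \<in> u" if "Box i A \<in> u" for A
    using that mcs_theorem assms(2) mcs_mp by blast
  then show ?thesis
    using assms(3,4) by (auto simp: canonical_rel_def)
qed

lemma mcs_avoiding:
  assumes "A \<notin> L"
  obtains w where "mcs L w" "A \<notin> w"
proof -
  have "\<not> derives L ({} \<union> {A \<rightarrow>\<^sub>m Bot}) Bot"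
  proof
    assume "derives L ({} \<union> {A \<rightarrow>\<^sub>m Bot}) Bot"
    then obtain Bs where "set Bs \<subseteq> {A \<rightarrow>\<^sub>m Bot}" "derives L {} (imps Bs Bot)"
      using deduction by blast
    moreover from this have "imps Bs Bot \<rightarrow>\<^sub>m A \<in> L"
      by (intro taut) (auto simp: tautology_def peval_imps)
    moreover have "imps Bs Bot \<in> L"
      using calculation(2) by (simp add: derives_def)
    ultimately show False
      using assms mp by blast
  qed
  then obtain w where "mcs L w" "A \<rightarrow>\<^sub>m Bot \<in> w"
    using lindenbaum by (metis Un_empty_left insert_subset)
  then show ?thesis
    using that mcs_mp mcs_Bot by blast
qed

end

text \<open>Here \<open>Delta\<close> enters: a formula in the \<open>j\<close>-type is closed and
  free of \<open>Box i\<close>, so \<open>Delta\<close> supplies its box at \<open>w\<close> and it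
  passes to \<open>v\<close>.\<close>

lemma closed_type_canonical_rel:
  assumes "normal_logic L" "Delta \<subseteq> L" "mcs L w" "mcs L v" "canonical_rel i w v" "j \<noteq> i"
  shows "closed_type j v = closed_type j w"
proof -
  interpret normal L
    using assms(1) by unfold_locales
  have "B \<in> v" if "B \<in> closed_type j w" for B
  proof -
    have "B \<rightarrow>\<^sub>m Box i B \<in> Delta"
      using that assms(6) by (cases i) (auto simp: Delta_def closed_type_def)
    then have "B \<rightarrow>\<^sub>m Box i B \<in> w"
      using assms(2,3) mcs_theorem by blast
    moreover have "B \<in> w"
      using that by (simp add: closed_type_def)
    ultimately have "Box i B \<in> w"
      using assms(3) mcs_mp by blast
    then show ?thesis
      using assms(5) by (simp add: canonical_rel_def)
  qed
  then show ?thesis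
    using assms(3,4) by (intro closed_type_eq) auto
qed

section \<open>Products of topologies on trees\<close>

definition cone :: "(nat \<times> 'w) list set \<Rightarrow> nat \<Rightarrow> (nat \<times> 'w) list \<Rightarrow> (nat \<times> 'w) list set" where
  "cone X k \<alpha> = {\<gamma> @ \<alpha> | \<gamma>. \<gamma> \<noteq> [] \<and> (\<forall>p\<in>set \<gamma>. k \<le> fst p) \<and> \<gamma> @ \<alpha> \<in> X}"

text \<open>The labelling \<open>e\<close> copies the tree into a prescribed carrier type. Cones
  omit their apex, which suits punctured neighborhoods.\<close>

definition cone_topology :: "(nat \<times> 'w) list set \<Rightarrow> ((nat \<times> 'w) list \<Rightarrow> 'a) \<Rightarrow> 'a topology" where
  "cone_topology X e =
     topology (\<lambda>U. U \<subseteq> e ` X \<and> (\<forall>\<alpha>\<in>X. e \<alpha> \<in> U \<longrightarrow> (\<exists>k. e ` cone X k \<alpha> \<subseteq> U)))"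

lemma cone_subset: "cone X k \<alpha> \<subseteq> X"
  by (auto simp: cone_def)

lemma cone_antimono: "k \<le> l \<Longrightarrow> cone X l \<alpha> \<subseteq> cone X k \<alpha>"
  unfolding cone_def by fastforce

lemma not_in_cone_self: "\<alpha> \<notin> cone X k \<alpha>"
  by (auto simp: cone_def)

lemma cone_trans:
  assumes "\<beta> \<in> cone X k \<alpha>"
  shows "cone X k \<beta> \<subseteq> cone X k \<alpha>"
proof
  fix \<delta>
  assume "\<delta> \<in> cone X k \<beta>"
  then obtain \<gamma> where \<gamma>: "\<delta> = \<gamma> @ \<beta>" "\<forall>p\<in>set \<gamma>. k \<le> fst p" "\<delta> \<in> X"
    unfolding cone_def by blast
  obtain \<gamma>' where \<gamma>': "\<beta> = \<gamma>' @ \<alpha>" "\<gamma>' \<noteq> []" "\<forall>p\<in>set \<gamma>'. k \<le> fst p"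
    using assms unfolding cone_def by blast
  show "\<delta> \<in> cone X k \<alpha>"
    unfolding cone_def using \<gamma> \<gamma>' by (intro CollectI exI[of _ "\<gamma> @ \<gamma>'"]) auto
qed

lemma openin_cone_topology:
  "openin (cone_topology X e) U \<longleftrightarrow>
     U \<subseteq> e ` X \<and> (\<forall>\<alpha>\<in>X. e \<alpha> \<in> U \<longrightarrow> (\<exists>k. e ` cone X k \<alpha> \<subseteq> U))"
proof -
  let ?P = "\<lambda>U. U \<subseteq> e ` X \<and> (\<forall>\<alpha>\<in>X. e \<alpha> \<in> U \<longrightarrow> (\<exists>k. e ` cone X k \<alpha> \<subseteq> U))"
  have "istopology ?P"
    unfolding istopology_def
  proof (rule conjI; intro allI impI)
    fix S T
    assume S: "?P S" and T: "?P T"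
    have nbhd: "\<exists>k. e ` cone X k \<alpha> \<subseteq> S \<inter> T" if \<alpha>: "\<alpha> \<in> X" "e \<alpha> \<in> S \<inter> T" for \<alpha>
    proof -
      obtain k l where "e ` cone X k \<alpha> \<subseteq> S" "e ` cone X l \<alpha> \<subseteq> T"
        using S T \<alpha> by blast
      moreover have "cone X (max k l) \<alpha> \<subseteq> cone X k \<alpha> \<inter> cone X l \<alpha>"
        by (intro Int_greatest cone_antimono) auto
      ultimately have "e ` cone X (max k l) \<alpha> \<subseteq> S \<inter> T"
        by blast
      then show ?thesis ..
    qed
    show "?P (S \<inter> T)"
      by (intro conjI ballI impI nbhd le_infI1) (simp_all add: S)
  next
    fix K
    assume K: "\<forall>S\<in>K. ?P S"
    have nbhd: "\<exists>k. e ` cone X k \<alpha> \<subseteq> \<Union>K" if \<alpha>: "\<alpha> \<in> X" "e \<alpha> \<in> \<Union>K" for \<alpha>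
    proof -
      obtain S where "S \<in> K" "e \<alpha> \<in> S"
        using \<alpha>(2) by blast
      then obtain k where "e ` cone X k \<alpha> \<subseteq> S"
        using K \<alpha>(1) by blast
      then show ?thesis
        using \<open>S \<in> K\<close> by blast
    qed
    show "?P (\<Union>K)"
      by (intro conjI ballI impI nbhd Union_least) (simp_all add: K)
  qed
  then show ?thesis
    unfolding cone_topology_def by (simp add: topology_inverse')
qed

lemma topspace_cone_topology: "topspace (cone_topology X e) = e ` X"
proof
  show "topspace (cone_topology X e) \<subseteq> e ` X"
    using openin_topspace[of "cone_topology X e"] unfolding openin_cone_topology by blast
  have "openin (cone_topology X e) (e ` X)"
    unfolding openin_cone_topology
    by (intro conjI ballI impI exI[of _ 0] image_mono cone_subset subset_refl)
  then show "e ` X \<subseteq> topspace (cone_topology X e)"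
    by (rule openin_subset)
qed

text \<open>By \<open>cone_trans\<close> the bound \<open>k\<close> that works at the apex works at
  every other point of the set.\<close>

lemma openin_insert_cone:
  assumes "inj_on e X" "\<alpha> \<in> X"
  shows "openin (cone_topology X e) (e ` insert \<alpha> (cone X k \<alpha>))"
  unfolding openin_cone_topology
proof (intro conjI ballI impI)
  have sub: "insert \<alpha> (cone X k \<alpha>) \<subseteq> X"
    using assms(2) cone_subset by simp
  then show "e ` insert \<alpha> (cone X k \<alpha>) \<subseteq> e ` X"
    by (rule image_mono)
  fix \<beta>
  assume "\<beta> \<in> X" "e \<beta> \<in> e ` insert \<alpha> (cone X k \<alpha>)"
  then have "\<beta> \<in> insert \<alpha> (cone X k \<alpha>)"
    using inj_on_image_mem_iff[OF assms(1) _ sub] by simp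
  then have "cone X k \<beta> \<subseteq> cone X k \<alpha>"
    using cone_trans by blast
  then have "e ` cone X k \<beta> \<subseteq> e ` insert \<alpha> (cone X k \<alpha>)"
    by (intro image_mono) blast
  then show "\<exists>l. e ` cone X l \<beta> \<subseteq> e ` insert \<alpha> (cone X k \<alpha>)" ..
qed

lemma label_bound:
  fixes \<beta> :: "(nat \<times> 'w) list"
  obtains k where "\<forall>p\<in>set \<beta>. fst p < k"
  using finite_nat_set_iff_bounded[of "fst ` set \<beta>"] by auto

text \<open>Any element of the cone at \<open>\<alpha>\<close> carries a stamp of at least
  \<open>k\<close>, so choosing \<open>k\<close> above all stamps of \<open>\<beta>\<close> keeps
  \<open>\<beta>\<close> out.\<close>

lemma t1_space_cone_topology:
  assumes "inj_on e X"
  shows "t1_space (cone_topology X e)"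
  unfolding t1_space_def topspace_cone_topology
proof (intro ballI impI)
  fix x y
  assume "x \<in> e ` X" "y \<in> e ` X" "x \<noteq> y"
  then obtain \<alpha> \<beta> where \<alpha>: "x = e \<alpha>" "\<alpha> \<in> X" and \<beta>: "y = e \<beta>" "\<beta> \<in> X" and "\<alpha> \<noteq> \<beta>"
    by blast
  obtain k where k: "\<forall>p\<in>set \<beta>. fst p < k"
    by (rule label_bound)
  have "\<beta> \<notin> cone X k \<alpha>"
  proof
    assume "\<beta> \<in> cone X k \<alpha>"
    then obtain \<gamma> where "\<beta> = \<gamma> @ \<alpha>" "\<gamma> \<noteq> []" "\<forall>p\<in>set \<gamma>. k \<le> fst p"
      unfolding cone_def by blast
    then show False
      using k by (cases \<gamma>) auto
  qed
  then have "y \<notin> e ` insert \<alpha> (cone X k \<alpha>)"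
    unfolding \<beta> using inj_on_image_mem_iff[OF assms \<beta>(2)] \<alpha>(2) \<open>\<alpha> \<noteq> \<beta>\<close> cone_subset
    by (metis insert_iff insert_subset)
  then show "\<exists>U. openin (cone_topology X e) U \<and> x \<in> U \<and> y \<notin> U"
    using openin_insert_cone[OF assms \<alpha>(2), of k] \<alpha>(1)
    by (intro exI[of _ "e ` insert \<alpha> (cone X k \<alpha>)"]) simp
qed

text \<open>Turns the derivational box clause into a clause about cones. Injectivity of
  \<open>e\<close> keeps the image of a cone away from \<open>e \<alpha>\<close>.\<close>

lemma punctured_nbhd_cone_topology:
  assumes "inj_on e X" "\<alpha> \<in> X"
  shows "(\<exists>U. openin (cone_topology X e) U \<and> e \<alpha> \<in> U \<and> (\<forall>y\<in>U - {e \<alpha>}. P y)) \<longleftrightarrow>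
    (\<exists>k. \<forall>\<beta>\<in>cone X k \<alpha>. P (e \<beta>))" (is "?L \<longleftrightarrow> ?R")
proof
  assume ?L
  then obtain U where U: "openin (cone_topology X e) U" "e \<alpha> \<in> U" "\<forall>y\<in>U - {e \<alpha>}. P y"
    by blast
  then obtain k where k: "e ` cone X k \<alpha> \<subseteq> U"
    using assms(2) unfolding openin_cone_topology by blast
  have "P (e \<beta>)" if "\<beta> \<in> cone X k \<alpha>" for \<beta>
  proof -
    have "\<beta> \<in> X" "\<beta> \<noteq> \<alpha>"
      using that cone_subset not_in_cone_self by blast+
    then have "e \<beta> \<noteq> e \<alpha>"
      using assms by (auto dest: inj_onD)
    then show ?thesis
      using U(3) k that by blast
  qed
  then show ?R
    by blast
next
  assume ?R
  then obtain k where "\<forall>\<beta>\<in>cone X k \<alpha>. P (e \<beta>)" ..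
  then show ?L
    using openin_insert_cone[OF assms, of k] by (intro exI[of _ "e ` insert \<alpha> (cone X k \<alpha>)"]) auto
qed

section \<open>Typed Kripke frames and the merging of two sequences of moves\<close>

primrec ksat :: "'w set \<Rightarrow> ('i \<Rightarrow> 'w \<Rightarrow> 'w \<Rightarrow> bool) \<Rightarrow> (nat \<Rightarrow> 'w set) \<Rightarrow> 'w \<Rightarrow> 'i fm \<Rightarrow> bool" where
  "ksat W R V w (Var p) \<longleftrightarrow> w \<in> V p"
| "ksat W R V w Bot \<longleftrightarrow> False"
| "ksat W R V w (A \<rightarrow>\<^sub>m B) \<longleftrightarrow> (ksat W R V w A \<longrightarrow> ksat W R V w B)"
| "ksat W R V w (Box i A) \<longleftrightarrow> (\<forall>v\<in>W. R i w v \<longrightarrow> ksat W R V v A)"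

text \<open>These are the features of the canonical model that the construction uses: a step along
  \<open>R i\<close> preserves the other type, and points of equal \<open>i\<close>-type can reach
  the same \<open>i\<close>-types along \<open>R i\<close>.\<close>

locale typed_frame =
  fixes W :: "'w set" and R :: "modality \<Rightarrow> 'w \<Rightarrow> 'w \<Rightarrow> bool"
    and t :: "modality \<Rightarrow> 'w \<Rightarrow> 't" and root :: 'w
  assumes root: "root \<in> W"
    and R_trans: "\<lbrakk>u \<in> W; v \<in> W; w \<in> W; R i u v; R i v w\<rbrakk> \<Longrightarrow> R i u w"
    and type_eq: "\<lbrakk>u \<in> W; v \<in> W; R i u v; j \<noteq> i\<rbrakk> \<Longrightarrow> t j v = t j u"
    and type_forward: "\<lbrakk>w \<in> W; u \<in> W; u' \<in> W; t i w = t i u; R i u u'\<rbrakk>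
      \<Longrightarrow> \<exists>v\<in>W. R i w v \<and> t i v = t i u'"
begin

text \<open>The first branch reaches the named target exactly, which is how every successor is
  attained in \<open>cone_merge_M1\<close>. The second chooses a substitute of the same
  \<open>i\<close>-type.\<close>

definition move :: "modality \<Rightarrow> 'w \<Rightarrow> 'w \<Rightarrow> 'w" where
  "move i w a = (if R i w a then a else SOME v. v \<in> W \<and> R i w v \<and> t i v = t i a)"

text \<open>The latest move is at the head of the list, so that cones prepend.\<close>

fun tip :: "(nat \<times> 'w) list \<Rightarrow> 'w" where
  "tip [] = root"
| "tip ((n, a) # \<alpha>) = a"

text \<open>\<open>tip \<alpha>\<close> is the target last named, not the point reached, so
  admissibility is decided within one coordinate; \<open>merge_type\<close> shows that both have the
  same \<open>i\<close>-type.\<close>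

fun admissible :: "modality \<Rightarrow> (nat \<times> 'w) list \<Rightarrow> bool" where
  "admissible i [] \<longleftrightarrow> True"
| "admissible i ((n, a) # \<alpha>) \<longleftrightarrow>
     admissible i \<alpha> \<and> a \<in> W \<and> (\<exists>u\<in>W. t i u = t i (tip \<alpha>) \<and> R i u a)"

text \<open>Each list keeps its own order, even where its stamps do not increase; the stamps only
  arbitrate between the two heads. On a tie the move of the second list is executed last.\<close>

fun merge :: "(nat \<times> 'w) list \<Rightarrow> (nat \<times> 'w) list \<Rightarrow> 'w" where
  "merge [] [] = root"
| "merge ((m, a) # \<alpha>) [] = move M1 (merge \<alpha> []) a"
| "merge [] ((n, b) # \<beta>) = move M2 (merge [] \<beta>) b"
| "merge ((m, a) # \<alpha>) ((n, b) # \<beta>) =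
     (if n < m then move M1 (merge \<alpha> ((n, b) # \<beta>)) a
      else move M2 (merge ((m, a) # \<alpha>) \<beta>) b)"

text \<open>The target \<open>a\<close> is known to be reachable only from some point of the same
  \<open>i\<close>-type as \<open>w\<close>; \<open>type_forward\<close> carries that step over to
  \<open>w\<close>.\<close>

lemma move:
  assumes "w \<in> W" "a \<in> W" "\<exists>u\<in>W. t i u = t i w \<and> R i u a"
  shows "move i w a \<in> W" "R i w (move i w a)" "t i (move i w a) = t i a"
    and "j \<noteq> i \<Longrightarrow> t j (move i w a) = t j w"
proof -
  obtain u where "u \<in> W" "t i w = t i u" "R i u a"
    using assms(3) by metis
  then have "\<exists>v. v \<in> W \<and> R i w v \<and> t i v = t i a"
    using type_forward[of w u a] assms by blast
  from someI_ex[OF this] show *: "move i w a \<in> W" "R i w (move i w a)" "t i (move i w a) = t i a"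
    using assms(2) by (auto simp: move_def)
  then show "j \<noteq> i \<Longrightarrow> t j (move i w a) = t j w"
    using type_eq assms(1) by blast
qed

text \<open>The invariant that makes every admissible move executable: a move gives its own type the
  value at the named target, whichever point is reached, and leaves the other type alone.\<close>

lemma merge_type:
  assumes "admissible M1 \<alpha>" "admissible M2 \<beta>"
  shows "merge \<alpha> \<beta> \<in> W \<and> t M1 (merge \<alpha> \<beta>) = t M1 (tip \<alpha>) \<and> t M2 (merge \<alpha> \<beta>) = t M2 (tip \<beta>)"
  using assms
proof (induction \<alpha> \<beta> rule: merge.induct)
  case 1
  then show ?case
    using root by simp
next
  case (2 m a \<alpha>)
  then show ?case
    using move[of "merge \<alpha> []" a M1] by auto
next
  case (3 n b \<beta>)
  then show ?case
    using move[of "merge [] \<beta>" b M2] by auto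
next
  case (4 m a \<alpha> n b \<beta>)
  show ?case
  proof (cases "n < m")
    case True
    then show ?thesis
      using 4 move[of "merge \<alpha> ((n, b) # \<beta>)" a M1] by auto
  next
    case False
    then show ?thesis
      using 4 move[of "merge ((m, a) # \<alpha>) \<beta>" b M2] by auto
  qed
qed

text \<open>A stamp above all stamps of the other list wins the comparison with the head of that
  list.\<close>

lemma merge_Cons:
  shows "\<forall>p\<in>set \<beta>. fst p < m \<Longrightarrow> merge ((m, a) # \<alpha>) \<beta> = move M1 (merge \<alpha> \<beta>) a"
    and "\<forall>p\<in>set \<alpha>. fst p < n \<Longrightarrow> merge \<alpha> ((n, b) # \<beta>) = move M2 (merge \<alpha> \<beta>) b"
  by (cases \<beta> rule: list.exhaust; auto) (cases \<alpha> rule: list.exhaust; auto)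

text \<open>All of \<open>\<gamma>\<close> is executed after \<open>\<alpha>\<close> and
  \<open>\<beta>\<close>, one \<open>R M1\<close>-step per move, and transitivity contracts this
  path.\<close>

lemma merge_append_M1:
  assumes "\<gamma> \<noteq> []" "\<forall>p\<in>set \<gamma>. k \<le> fst p" "\<forall>p\<in>set \<beta>. fst p < k"
    and "admissible M1 (\<gamma> @ \<alpha>)" "admissible M1 \<alpha>" "admissible M2 \<beta>"
  shows "R M1 (merge \<alpha> \<beta>) (merge (\<gamma> @ \<alpha>) \<beta>)"
  using assms
proof (induction \<gamma>)
  case (Cons p \<gamma>)
  obtain m a where p: "p = (m, a)"
    by fastforce
  let ?w = "merge (\<gamma> @ \<alpha>) \<beta>"
  have adm: "admissible M1 (\<gamma> @ \<alpha>)" "a \<in> W" "\<exists>u\<in>W. t M1 u = t M1 (tip (\<gamma> @ \<alpha>)) \<and> R M1 u a"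
    using Cons.prems(4) by (auto simp: p)
  have w: "?w \<in> W" "t M1 ?w = t M1 (tip (\<gamma> @ \<alpha>))"
    using merge_type[OF adm(1) assms(6)] by auto
  have "\<forall>q\<in>set \<beta>. fst q < m"
    using Cons.prems(2,3) by (fastforce simp: p)
  then have eq: "merge ((p # \<gamma>) @ \<alpha>) \<beta> = move M1 ?w a"
    by (simp add: p merge_Cons)
  have step: "move M1 ?w a \<in> W" "R M1 ?w (move M1 ?w a)"
    using move(1,2)[of ?w a M1] w adm(2,3) by auto
  show ?case
  \<comment> \<open>\<open>R M1\<close> need not be reflexive, so a path of length one is treated
    separately.\<close>
  proof (cases "\<gamma> = []")
    case True
    then show ?thesis
      using step(2) eq by simp
  next
    case False
    then have "R M1 (merge \<alpha> \<beta>) ?w"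
      using Cons adm(1) by simp
    then show ?thesis
      unfolding eq using R_trans step w(1) merge_type[OF assms(5,6)] by blast
  qed
qed simp

lemma merge_append_M2:
  assumes "\<gamma> \<noteq> []" "\<forall>p\<in>set \<gamma>. k \<le> fst p" "\<forall>p\<in>set \<alpha>. fst p < k"
    and "admissible M2 (\<gamma> @ \<beta>)" "admissible M2 \<beta>" "admissible M1 \<alpha>"
  shows "R M2 (merge \<alpha> \<beta>) (merge \<alpha> (\<gamma> @ \<beta>))"
  using assms
proof (induction \<gamma>)
  case (Cons p \<gamma>)
  obtain m a where p: "p = (m, a)"
    by fastforce
  let ?w = "merge \<alpha> (\<gamma> @ \<beta>)"
  have adm: "admissible M2 (\<gamma> @ \<beta>)" "a \<in> W" "\<exists>u\<in>W. t M2 u = t M2 (tip (\<gamma> @ \<beta>)) \<and> R M2 u a"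
    using Cons.prems(4) by (auto simp: p)
  have w: "?w \<in> W" "t M2 ?w = t M2 (tip (\<gamma> @ \<beta>))"
    using merge_type[OF assms(6) adm(1)] by auto
  have "\<forall>q\<in>set \<alpha>. fst q < m"
    using Cons.prems(2,3) by (fastforce simp: p)
  then have eq: "merge \<alpha> ((p # \<gamma>) @ \<beta>) = move M2 ?w a"
    by (simp add: p merge_Cons)
  have step: "move M2 ?w a \<in> W" "R M2 ?w (move M2 ?w a)"
    using move(1,2)[of ?w a M2] w adm(2,3) by auto
  show ?case
  proof (cases "\<gamma> = []")
    case True
    then show ?thesis
      using step(2) eq by simp
  next
    case False
    then have "R M2 (merge \<alpha> \<beta>) ?w"
      using Cons adm(1) by simp
    then show ?thesis
      unfolding eq using R_trans step w(1) merge_type[OF assms(6,5)] by blast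
  qed
qed simp

abbreviation tree :: "modality \<Rightarrow> (nat \<times> 'w) list set" where
  "tree i \<equiv> {\<alpha>. admissible i \<alpha>}"

text \<open>The bound \<open>k\<close> may depend on \<open>\<beta>\<close>. This freedom lets the
  extensions of \<open>\<alpha>\<close> be executed after all moves of \<open>\<beta>\<close>,
  although the topology on the first tree does not know \<open>\<beta>\<close>.\<close>

lemma cone_merge_M1:
  assumes "admissible M1 \<alpha>" "admissible M2 \<beta>"
  shows "(\<exists>k. \<forall>\<alpha>'\<in>cone (tree M1) k \<alpha>. P (merge \<alpha>' \<beta>)) \<longleftrightarrow>
    (\<forall>v\<in>W. R M1 (merge \<alpha> \<beta>) v \<longrightarrow> P v)" (is "?L \<longleftrightarrow> ?R")
proof
  obtain l where l: "\<forall>p\<in>set \<beta>. fst p < l"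
    by (rule label_bound)
  note w = merge_type[OF assms]
  show ?R if ?L
  proof (intro ballI impI)
    fix v
    assume v: "v \<in> W" "R M1 (merge \<alpha> \<beta>) v"
    obtain k where k: "\<forall>\<alpha>'\<in>cone (tree M1) k \<alpha>. P (merge \<alpha>' \<beta>)"
      using \<open>?L\<close> ..
    \<comment> \<open>The stamp \<open>max k l\<close> lies in the given cone and above all stamps
      of \<open>\<beta>\<close>, so the new move comes last and reaches \<open>v\<close>
      itself.\<close>
    have "[(max k l, v)] @ \<alpha> \<in> cone (tree M1) k \<alpha>"
      unfolding cone_def using v w assms(1)
      by (intro CollectI exI[of _ "[(max k l, v)]"]) auto
    then have "P (merge ((max k l, v) # \<alpha>) \<beta>)"
      using k by fastforce
    moreover have "merge ((max k l, v) # \<alpha>) \<beta> = v"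
      using l v(2) by (subst merge_Cons) (auto simp: move_def less_max_iff_disj)
    ultimately show "P v"
      by simp
  qed
  show ?L if ?R
  \<comment> \<open>The bound \<open>l\<close> on the stamps of \<open>\<beta>\<close> serves as
    \<open>k\<close>.\<close>
  proof (intro exI ballI)
    fix \<alpha>'
    assume "\<alpha>' \<in> cone (tree M1) l \<alpha>"
    then obtain \<gamma> where "\<alpha>' = \<gamma> @ \<alpha>" "\<gamma> \<noteq> []" "\<forall>p\<in>set \<gamma>. l \<le> fst p" "admissible M1 \<alpha>'"
      unfolding cone_def by blast
    then show "P (merge \<alpha>' \<beta>)"
      using \<open>?R\<close> merge_append_M1 l assms merge_type by blast
  qed
qed

lemma cone_merge_M2:
  assumes "admissible M1 \<alpha>" "admissible M2 \<beta>"
  shows "(\<exists>k. \<forall>\<beta>'\<in>cone (tree M2) k \<beta>. P (merge \<alpha> \<beta>')) \<longleftrightarrow>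
    (\<forall>v\<in>W. R M2 (merge \<alpha> \<beta>) v \<longrightarrow> P v)" (is "?L \<longleftrightarrow> ?R")
proof
  obtain l where l: "\<forall>p\<in>set \<alpha>. fst p < l"
    by (rule label_bound)
  note w = merge_type[OF assms]
  show ?R if ?L
  proof (intro ballI impI)
    fix v
    assume v: "v \<in> W" "R M2 (merge \<alpha> \<beta>) v"
    obtain k where k: "\<forall>\<beta>'\<in>cone (tree M2) k \<beta>. P (merge \<alpha> \<beta>')"
      using \<open>?L\<close> ..
    have "[(max k l, v)] @ \<beta> \<in> cone (tree M2) k \<beta>"
      unfolding cone_def using v w assms(2)
      by (intro CollectI exI[of _ "[(max k l, v)]"]) auto
    then have "P (merge \<alpha> ((max k l, v) # \<beta>))"
      using k by fastforce
    moreover have "merge \<alpha> ((max k l, v) # \<beta>) = v"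
      using l v(2) by (subst merge_Cons) (auto simp: move_def less_max_iff_disj)
    ultimately show "P v"
      by simp
  qed
  show ?L if ?R
  proof (intro exI ballI)
    fix \<beta>'
    assume "\<beta>' \<in> cone (tree M2) l \<beta>"
    then obtain \<gamma> where "\<beta>' = \<gamma> @ \<beta>" "\<gamma> \<noteq> []" "\<forall>p\<in>set \<gamma>. l \<le> fst p" "admissible M2 \<beta>'"
      unfolding cone_def by blast
    then show "P (merge \<alpha> \<beta>')"
      using \<open>?R\<close> merge_append_M2 l assms merge_type by blast
  qed
qed

text \<open>\<open>merge\<close> acts as a bounded morphism from the product to the Kripke frame,
  and \<open>V'\<close> is the preimage of \<open>V\<close> under it.\<close>

lemma sat_merge:
  fixes e\<^sub>1 :: "(nat \<times> 'w) list \<Rightarrow> 'a" and e\<^sub>2 :: "(nat \<times> 'w) list \<Rightarrow> 'b"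
    and V :: "nat \<Rightarrow> 'w set"
  assumes inj: "inj_on e\<^sub>1 (tree M1)" "inj_on e\<^sub>2 (tree M2)"
    and "admissible M1 \<alpha>" "admissible M2 \<beta>"
  defines "F \<equiv> \<N>\<^sub>d (cone_topology (tree M1) e\<^sub>1) \<times>\<^sub>n \<N>\<^sub>d (cone_topology (tree M2) e\<^sub>2)"
    and "V' \<equiv> \<lambda>p. {(e\<^sub>1 \<alpha>, e\<^sub>2 \<beta>) | \<alpha> \<beta>. admissible M1 \<alpha> \<and> admissible M2 \<beta> \<and> merge \<alpha> \<beta> \<in> V p}"
  shows "sat F V' (e\<^sub>1 \<alpha>, e\<^sub>2 \<beta>) A \<longleftrightarrow> ksat W R V (merge \<alpha> \<beta>) A"
  using assms(3,4)
proof (induction A arbitrary: \<alpha> \<beta>)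
  case (Var p)
  \<comment> \<open>Injective labels determine the pair of sequences, so membership in
    \<open>V' p\<close> depends on this one pair.\<close>
  have "\<alpha>' = \<alpha> \<and> \<beta>' = \<beta>"
    if "e\<^sub>1 \<alpha> = e\<^sub>1 \<alpha>'" "e\<^sub>2 \<beta> = e\<^sub>2 \<beta>'" "admissible M1 \<alpha>'" "admissible M2 \<beta>'" for \<alpha>' \<beta>'
    using that Var inj by (auto dest: inj_onD)
  then show ?case
    using Var unfolding sat.simps ksat.simps V'_def by blast
next
  case (Box i A)
  show ?case
  proof (cases i)
    case M1
    have top: "e\<^sub>2 \<beta> \<in> topspace (cone_topology (tree M2) e\<^sub>2)"
      using Box.prems by (simp add: topspace_cone_topology)
    have "sat F V' (e\<^sub>1 \<alpha>, e\<^sub>2 \<beta>) (Box i A) \<longleftrightarrow>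
        (\<exists>k. \<forall>\<alpha>'\<in>cone (tree M1) k \<alpha>. sat F V' (e\<^sub>1 \<alpha>', e\<^sub>2 \<beta>) A)"
      unfolding M1 F_def sat_derivational_M1[OF top]
      using Box.prems inj by (intro punctured_nbhd_cone_topology) auto
    also have "\<dots> \<longleftrightarrow> (\<exists>k. \<forall>\<alpha>'\<in>cone (tree M1) k \<alpha>. ksat W R V (merge \<alpha>' \<beta>) A)"
      using Box.IH Box.prems(2) cone_subset[of "tree M1"] by (metis (no_types, lifting) mem_Collect_eq subsetD)
    also have "\<dots> \<longleftrightarrow> ksat W R V (merge \<alpha> \<beta>) (Box i A)"
      unfolding M1 ksat.simps by (rule cone_merge_M1[OF Box.prems])
    finally show ?thesis .
  next
    case M2
    have top: "e\<^sub>1 \<alpha> \<in> topspace (cone_topology (tree M1) e\<^sub>1)"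
      using Box.prems by (simp add: topspace_cone_topology)
    have "sat F V' (e\<^sub>1 \<alpha>, e\<^sub>2 \<beta>) (Box i A) \<longleftrightarrow>
        (\<exists>k. \<forall>\<beta>'\<in>cone (tree M2) k \<beta>. sat F V' (e\<^sub>1 \<alpha>, e\<^sub>2 \<beta>') A)"
      unfolding M2 F_def sat_derivational_M2[OF top]
      using Box.prems inj by (intro punctured_nbhd_cone_topology) auto
    also have "\<dots> \<longleftrightarrow> (\<exists>k. \<forall>\<beta>'\<in>cone (tree M2) k \<beta>. ksat W R V (merge \<alpha> \<beta>') A)"
      using Box.IH Box.prems(1) cone_subset[of "tree M2"] by (metis (no_types, lifting) mem_Collect_eq subsetD)
    also have "\<dots> \<longleftrightarrow> ksat W R V (merge \<alpha> \<beta>) (Box i A)"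
      unfolding M2 ksat.simps by (rule cone_merge_M2[OF Box.prems])
    finally show ?thesis .
  qed
qed simp_all

text \<open>Countability lets the tree be copied into any infinite carrier type.\<close>

lemma countable_tree:
  assumes "countable W"
  shows "countable (tree i)"
proof -
  have "\<alpha> \<in> lists (UNIV \<times> W)" if "admissible i \<alpha>" for \<alpha>
    using that by (induction i \<alpha> rule: admissible.induct) auto
  then have "tree i \<subseteq> lists (UNIV \<times> W)"
    by blast
  then show ?thesis
    using assms by (intro countable_subset[OF _ countable_lists]) auto
qed

end

lemma countable_inj_on_infinite_type:
  assumes "countable X" "infinite (UNIV :: 'a set)"
  obtains e :: "'x \<Rightarrow> 'a" where "inj_on e X"
proof -
  obtain f :: "nat \<Rightarrow> 'a" where "inj f"
    using infinite_countable_subset[OF assms(2)] by blast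
  then have "inj_on (f \<circ> to_nat_on X) X"
    using assms(1) by (intro comp_inj_on inj_on_to_nat_on) (auto intro: inj_on_subset)
  then show ?thesis ..
qed

lemma (in typed_frame) refuting_t1_product:
  assumes "infinite (UNIV :: 'a set)" "infinite (UNIV :: 'b set)"
    and "countable W" "\<not> ksat W R V root A"
  obtains X\<^sub>1 :: "'a topology" and X\<^sub>2 :: "'b topology"
  where "topspace X\<^sub>1 \<noteq> {}" "t1_space X\<^sub>1" "topspace X\<^sub>2 \<noteq> {}" "t1_space X\<^sub>2" "\<not> d_valid X\<^sub>1 X\<^sub>2 A"
proof -
  obtain e\<^sub>1 :: "(nat \<times> 'w) list \<Rightarrow> 'a" where e\<^sub>1: "inj_on e\<^sub>1 (tree M1)"
    using countable_inj_on_infinite_type countable_tree assms(1,3) by blast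
  obtain e\<^sub>2 :: "(nat \<times> 'w) list \<Rightarrow> 'b" where e\<^sub>2: "inj_on e\<^sub>2 (tree M2)"
    using countable_inj_on_infinite_type countable_tree assms(2,3) by blast
  let ?X = "cone_topology (tree M1) e\<^sub>1" and ?Y = "cone_topology (tree M2) e\<^sub>2"
  let ?V = "\<lambda>p. {(e\<^sub>1 \<alpha>, e\<^sub>2 \<beta>) | \<alpha> \<beta>. admissible M1 \<alpha> \<and> admissible M2 \<beta> \<and> merge \<alpha> \<beta> \<in> V p}"
  have not_sat: "\<not> sat (\<N>\<^sub>d ?X \<times>\<^sub>n \<N>\<^sub>d ?Y) ?V (e\<^sub>1 [], e\<^sub>2 []) A"
    using sat_merge[OF e\<^sub>1 e\<^sub>2, of "[]" "[]"] assms(4) by simp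
  have V: "\<forall>p. ?V p \<subseteq> topspace ?X \<times> topspace ?Y"
    unfolding topspace_cone_topology by blast
  have root: "(e\<^sub>1 [], e\<^sub>2 []) \<in> topspace ?X \<times> topspace ?Y"
    unfolding topspace_cone_topology by simp
  have "sat (\<N>\<^sub>d ?X \<times>\<^sub>n \<N>\<^sub>d ?Y) ?V (e\<^sub>1 [], e\<^sub>2 []) A" if "d_valid ?X ?Y A"
    using that[unfolded d_valid_def valid_def points_derivational_product,
        THEN spec, THEN mp, OF V, THEN bspec, OF root] .
  then have "\<not> d_valid ?X ?Y A"
    using not_sat by blast
  moreover have "topspace ?X \<noteq> {}" "topspace ?Y \<noteq> {}"
    using root by auto
  ultimately show ?thesis
    using that[of ?X ?Y] t1_space_cone_topology[OF e\<^sub>1] t1_space_cone_topology[OF e\<^sub>2] by simp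
qed

section \<open>Completeness\<close>

lemma countable_skolem_hull:
  fixes P :: "'j :: countable \<Rightarrow> 'w \<Rightarrow> 'w \<Rightarrow> 'w \<Rightarrow> bool"
  assumes "w \<in> W" and total: "\<And>j x y. x \<in> W \<Longrightarrow> y \<in> W \<Longrightarrow> \<exists>z\<in>W. P j x y z"
  obtains W' where "countable W'" "W' \<subseteq> W" "w \<in> W'"
    "\<And>j x y. x \<in> W' \<Longrightarrow> y \<in> W' \<Longrightarrow> \<exists>z\<in>W'. P j x y z"
proof -
  define g where "g = (\<lambda>(j, x, y). SOME z. z \<in> W \<and> P j x y z)"
  have g: "g (j, x, y) \<in> W \<and> P j x y (g (j, x, y))" if "x \<in> W" "y \<in> W" for j x y
  proof -
    have "\<exists>z. z \<in> W \<and> P j x y z"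
      using total[OF that, of j] by blast
    then show ?thesis
      unfolding g_def prod.case by (rule someI_ex)
  qed
  \<comment> \<open>Stage \<open>n\<close> of closing \<open>{w}\<close> under the Skolem function.
    The stages increase, so any two points of the union share a stage and their witness appears at
    the next.\<close>
  define S where "S n = ((\<lambda>S. S \<union> g ` (UNIV \<times> S \<times> S)) ^^ n) {w}" for n
  have S_Suc: "S (Suc n) = S n \<union> g ` (UNIV \<times> S n \<times> S n)" for n
    by (simp add: S_def)
  have S: "countable (S n) \<and> S n \<subseteq> W" for n
  proof (induction n)
    case 0
    show ?case
      using assms(1) by (simp add: S_def)
  next
    case (Suc n)
    then show ?case
      unfolding S_Suc using g by auto
  qed
  have mono: "S m \<subseteq> S n" if "m \<le> n" for m n
    using that by (rule lift_Suc_mono_le[rotated]) (auto simp: S_Suc)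
  have "\<exists>z\<in>\<Union>(range S). P j x y z" if xy: "x \<in> \<Union>(range S)" "y \<in> \<Union>(range S)" for j x y
  proof -
    obtain m n where "x \<in> S m" "y \<in> S n"
      using xy by blast
    then have "x \<in> S (max m n)" "y \<in> S (max m n)"
      using mono[of m "max m n"] mono[of n "max m n"] by auto
    then have "g (j, x, y) \<in> S (Suc (max m n))" "x \<in> W" "y \<in> W"
      using S by (auto simp: S_Suc)
    then show ?thesis
      using g by blast
  qed
  moreover have "w \<in> \<Union>(range S)"
    by (rule UN_I[of 0]) (simp_all add: S_def)
  moreover have "countable (\<Union>(range S))" "\<Union>(range S) \<subseteq> W"
    using S by (simp_all add: UN_least)
  ultimately show ?thesis
    using that[of "\<Union>(range S)"] by blast
qed

instance modality :: countable
  by countable_datatype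

instance fm :: (countable) countable
  by countable_datatype

text \<open>Transitivity and preservation of types are universal conditions, inherited by every
  subset of the canonical model; the Skolem hull secures the existential ones.\<close>

lemma countable_typed_frame:
  fixes L :: "modality fm set"
  assumes L: "normal_logic L" "Delta \<subseteq> L"
    and four: "\<And>i. Box i (Var 0) \<rightarrow>\<^sub>m Box i (Box i (Var 0)) \<in> L"
    and "A \<notin> L"
  obtains W w where "countable W" "typed_frame W canonical_rel closed_type w"
    "\<not> ksat W canonical_rel (\<lambda>p. {w. Var p \<in> w}) w A"
proof -
  interpret normal L
    using L(1) by unfold_locales
  obtain w where w: "mcs L w" "A \<notin> w"
    using mcs_avoiding assms(4) by blast
  \<comment> \<open>The two demands are a witness for a false box and a substitute target for
    \<open>type_forward\<close>. Quantifying \<open>u\<close> inside \<open>P\<close> makes the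
    second depend on \<open>x\<close> and \<open>y\<close> alone, so two arguments suffice.\<close>
  define P where "P j x y z = (case j of
      (i, Some C) \<Rightarrow> Box i C \<notin> x \<longrightarrow> canonical_rel i x z \<and> C \<notin> z
    | (i, None) \<Rightarrow> (\<exists>u. mcs L u \<and> closed_type i x = closed_type i u \<and> canonical_rel i u y) \<longrightarrow>
        canonical_rel i x z \<and> closed_type i z = closed_type i y)"
    for j :: "modality \<times> modality fm option" and x y z
  have total: "\<exists>z\<in>{w. mcs L w}. P j x y z" if "x \<in> {w. mcs L w}" "y \<in> {w. mcs L w}" for j x y
  proof (cases "snd j")
    case None
    then show ?thesis
      using that closed_type_forward[of x _ y "fst j"]
      by (cases j) (simp add: P_def, metis)
  next
    case (Some C)
    then show ?thesis
      using that canonical_witness[of x "fst j" C]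
      by (cases j) (simp add: P_def, metis)
  qed
  obtain W where W: "countable W" "W \<subseteq> {w. mcs L w}" "w \<in> W"
    and P: "\<And>j x y. x \<in> W \<Longrightarrow> y \<in> W \<Longrightarrow> \<exists>z\<in>W. P j x y z"
    using countable_skolem_hull[of w "{w. mcs L w}" P, OF _ total] w(1) by blast
  have mcs: "mcs L u" if "u \<in> W" for u
    using W(2) that by blast
  have "typed_frame W canonical_rel closed_type w"
  proof
    fix i u v v'
    assume "u \<in> W" "canonical_rel i u v" "canonical_rel i v v'"
    then show "canonical_rel i u v'"
      using canonical_rel_trans[OF four] mcs by blast
  next
    fix i j u v
    assume "u \<in> W" "v \<in> W" "canonical_rel i u v" "j \<noteq> i"
    then show "closed_type j v = closed_type j u"
      using closed_type_canonical_rel[OF L] mcs by blast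
  next
    fix i x u y
    assume "x \<in> W" "u \<in> W" "y \<in> W" "closed_type i x = closed_type i u" "canonical_rel i u y"
    then show "\<exists>z\<in>W. canonical_rel i x z \<and> closed_type i z = closed_type i y"
      using P[of x y "(i, None)"] mcs[of u] unfolding P_def by auto
  qed (fact W(3))
  moreover have truth: "ksat W canonical_rel (\<lambda>p. {w. Var p \<in> w}) u C \<longleftrightarrow> C \<in> u" if "u \<in> W" for u C
    using that
  proof (induction C arbitrary: u)
    case Bot
    then show ?case
      using mcs_Bot mcs by auto
  next
    case (Imp B C)
    then show ?case
      using mcs_Imp mcs by auto
  next
    case (Box i C)
    \<comment> \<open>The demand for a false box ignores its second point, so \<open>u\<close> fills
      that place as well.\<close>
    have "Box i C \<in> u" if "\<forall>v\<in>W. canonical_rel i u v \<longrightarrow> C \<in> v"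
      using P[OF Box.prems Box.prems, of "(i, Some C)"] that unfolding P_def by auto
    moreover have "C \<in> v" if "Box i C \<in> u" "canonical_rel i u v" for v
      using that by (simp add: canonical_rel_def)
    ultimately show ?case
      using Box by auto
  qed simp
  ultimately show ?thesis
    using that W(1,3) w(2) by blast
qed

text \<open>Spaces range over one fixed pair of carrier types. Infinite types have room for the
  countable trees that refute each formula outside the logic.\<close>

theorem theorem9p2:
  assumes "infinite (UNIV :: 'a set)" and "infinite (UNIV :: 'b set)"
  shows "{A. \<forall>(X\<^sub>1 :: 'a topology) (X\<^sub>2 :: 'b topology).
            topspace X\<^sub>1 \<noteq> {} \<and> t1_space X\<^sub>1 \<and> topspace X\<^sub>2 \<noteq> {} \<and> t1_space X\<^sub>2 \<longrightarrow>
            d_valid X\<^sub>1 X\<^sub>2 A} = \<langle>logic_K4, logic_K4\<rangle>\<^sub>m"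
proof (intro subset_antisym subsetI CollectI allI impI)
  fix A
  assume A: "A \<in> {A. \<forall>(X\<^sub>1 :: 'a topology) (X\<^sub>2 :: 'b topology).
            topspace X\<^sub>1 \<noteq> {} \<and> t1_space X\<^sub>1 \<and> topspace X\<^sub>2 \<noteq> {} \<and> t1_space X\<^sub>2 \<longrightarrow>
            d_valid X\<^sub>1 X\<^sub>2 A}"
  show "A \<in> \<langle>logic_K4, logic_K4\<rangle>\<^sub>m"
  proof (rule ccontr)
    assume "A \<notin> \<langle>logic_K4, logic_K4\<rangle>\<^sub>m"
    moreover have "normal_logic \<langle>logic_K4, logic_K4\<rangle>\<^sub>m"
      unfolding fusion_Delta_def by (rule normal_logic_logic_plus)
    ultimately obtain W w where W: "countable W" "typed_frame W canonical_rel closed_type w"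
      "\<not> ksat W canonical_rel (\<lambda>p. {w. Var p \<in> w}) w A"
      using countable_typed_frame[OF _ Delta_subset_fusion_Delta transitivity_in_fusion_Delta]
      by metis
    interpret typed_frame W canonical_rel closed_type w
      by (fact W(2))
    obtain X\<^sub>1 :: "'a topology" and X\<^sub>2 :: "'b topology"
      where "topspace X\<^sub>1 \<noteq> {}" "t1_space X\<^sub>1" "topspace X\<^sub>2 \<noteq> {}" "t1_space X\<^sub>2" "\<not> d_valid X\<^sub>1 X\<^sub>2 A"
      by (rule refuting_t1_product[OF assms W(1,3)])
    then show False
      using A by simp
  qed
next
  fix A and X\<^sub>1 :: "'a topology" and X\<^sub>2 :: "'b topology"
  assume "A \<in> \<langle>logic_K4, logic_K4\<rangle>\<^sub>m"
    and "topspace X\<^sub>1 \<noteq> {} \<and> t1_space X\<^sub>1 \<and> topspace X\<^sub>2 \<noteq> {} \<and> t1_space X\<^sub>2"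
  then show "d_valid X\<^sub>1 X\<^sub>2 A"
    by (elim conjE) (rule d_valid_fusion_Delta_K4)
qed

end
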